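(* Let $n \ge 15$. Every connected graph $G$ of order $n$ whose isolation number equals $n/3$ belongs to the family $\mathcal{G}$.
   Context: All graphs are finite and simple. For $X\subseteq V(G)$, $N[X]$ is the closed neighborhood of $X$. An isolating set of $G$ is a set $X$ such that $G-N[X]$ has no edge; the isolation number is the minimum cardinality of an isolating set. The family $\mathcal{G}$ consists of the graphs constructed as follows: take a connected graph (the base graph, with at least one vertex); for each vertex $h$ of the base graph (called a hook), add a new disjoint copy $P_h$ of either $K_2$ or $C_5$ (the pendant of $h$), and join $h$ to some vertices of $P_h$: if $P_h$ is $K_2$, join $h$ to one or to both vertices of $P_h$; if $P_h$ is $C_5$, join $h$ to exactly one vertex, or to any two vertices, or to three consecutive vertices of the $5$-cycle. There are no other edges. *)

theory Defs
  imports Complex_Main "Graph_Theory.Graph_Theory"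
begin

definition closed_nbhd :: "'a pair_pre_digraph \<Rightarrow> 'a set \<Rightarrow> 'a set" where
  "closed_nbhd G X = X \<union> {v. \<exists>x\<in>X. (x, v) \<in> parcs G}"

definition isolating :: "'a pair_pre_digraph \<Rightarrow> 'a set \<Rightarrow> bool" where
  "isolating G X \<longleftrightarrow> X \<subseteq> pverts G \<and> arcs (G \<restriction> (pverts G - closed_nbhd G X)) = {}"

definition isolation_number :: "'a pair_pre_digraph \<Rightarrow> nat" where
  "isolation_number G = Min (card ` {X. isolating G X})"

definition cycle_graph :: "nat \<Rightarrow> (nat \<Rightarrow> 'a) \<Rightarrow> 'a pair_pre_digraph" where
  "cycle_graph k c =
    \<lparr> pverts = c ` {..<k},
      parcs = (\<Union>i<k. {(c i, c (Suc i mod k)), (c (Suc i mod k), c i)}) \<rparr>"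

text \<open>\<open>A\<close> is the set of vertices of the pendant \<open>P\<close> that its hook is joined to.\<close>

definition pendant :: "'a pair_pre_digraph \<Rightarrow> 'a set \<Rightarrow> bool" where
  "pendant P A \<longleftrightarrow> A \<subseteq> pverts P \<and>
    (complete_digraph 2 P \<and> card A \<in> {1, 2} \<or>
     (\<exists>c. inj_on c {..<5} \<and> P = cycle_graph 5 c \<and>
        (card A \<in> {1, 2} \<or>
         (\<exists>i<5. A = {c i, c ((i + 1) mod 5), c ((i + 2) mod 5)}))))"

text \<open>
  Here \<open>B\<close> is the base graph, and \<open>P h\<close> and \<open>A h\<close> are the pendant of the hook \<open>h\<close> and the set of
  vertices of that pendant joined to \<open>h\<close>. The pendants range over all copies of the complete graph on
  two vertices and of the 5-cycle inside the vertex type, so membership means being isomorphic to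
  a graph built in this way. Nonemptiness of the base graph is part of \<open>connected\<close>.
\<close>

definition hook_family :: "'a pair_pre_digraph set" where
  "hook_family = {G. \<exists>B P A.
     pair_graph B \<and> connected B \<and>
     (\<forall>h\<in>pverts B. pendant (P h) (A h) \<and> pverts (P h) \<inter> pverts B = {}) \<and>
     (\<forall>h\<in>pverts B. \<forall>h'\<in>pverts B. h \<noteq> h' \<longrightarrow> pverts (P h) \<inter> pverts (P h') = {}) \<and>
     G = \<lparr> pverts = pverts B \<union> (\<Union>h\<in>pverts B. pverts (P h)),
           parcs = parcs B \<union> (\<Union>h\<in>pverts B. parcs (P h) \<union> {h} \<times> A h \<union> A h \<times> {h}) \<rparr>}"

end

theory Submission
  imports Defs
begin

text \<open>
  Let \<open>S\<close> be a set of vertices whose edges are already taken care of, and let the bad components be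
  those isomorphic to the complete graph on two vertices or the 5-cycle that avoid \<open>S\<close>. The key quantity
  is the defect, the order plus the number of bad components minus three times the isolation number
  relative to \<open>S\<close>. It is superadditive over components and nonnegative. Deleting a vertex \<open>s\<close> of \<open>S\<close>
  costs nothing, so if the defect is zero and every component meets \<open>S\<close>, then deleting \<open>s\<close> must
  produce a bad component. Hence \<open>s\<close> is a hook, and after putting \<open>s\<close> into the isolating set the rest
  again has defect zero with all neighbours of \<open>s\<close> exempt; by induction the graph has the structure of
  the family. In a connected graph with equality the same step applies as soon as one pendant exists.

  If no pendant exists, each bad component of \<open>G - N[v]\<close> is joined to at least two neighbours of \<open>v\<close>.
  A hypergraph with \<open>m\<close> edges of size at least two on \<open>d\<close> points has a transversal of size at most
  \<open>(d + m) / 3\<close>; isolating with \<open>v\<close> and such a transversal shows that there are at most two bad components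
  and that all degrees are at most 4. After suitable two neighbours are removed along with \<open>v\<close>, the components
  that meet \<open>N(v)\<close> are hooked, and each of their pendants contains a neighbour of one of the two;
  dominating the hooks by some of them then saves so much that \<open>G - N[v]\<close> has at most 11 vertices and
  components of order at most 6 whenever \<open>v\<close> has degree at least 3. Applied to a vertex of a 5-cycle
  component of \<open>G - N[v]\<close>, this rules out degree at least 3 when the order is at least 15, which leaves
  only cycles.
\<close>

section \<open>Isolation with exempt vertices\<close>

locale ugraph =
  fixes E :: "'a \<Rightarrow> 'a \<Rightarrow> bool"
  assumes sym: "E x y \<Longrightarrow> E y x"
    and irrefl: "\<not> E x x"
begin

definition nbs :: "'a set \<Rightarrow> 'a set" where
  "nbs Y = {x. \<exists>y\<in>Y. E y x}"

definition anticomplete :: "'a set \<Rightarrow> 'a set \<Rightarrow> bool" where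
  "anticomplete A B \<longleftrightarrow> (\<forall>x\<in>A. \<forall>y\<in>B. \<not> E x y)"

text \<open>Connectivity through cuts instead of walks, so that a closed set refutes it directly.
  The agreement with reachability is shown only in the translation to
  \<open>connected\<close>.\<close>

definition conn :: "'a set \<Rightarrow> bool" where
  "conn W \<longleftrightarrow> W \<noteq> {} \<and> (\<forall>A\<subseteq>W. A \<noteq> {} \<longrightarrow> anticomplete A (W - A) \<longrightarrow> A = W)"

definition component :: "'a set \<Rightarrow> 'a set \<Rightarrow> bool" where
  "component C W \<longleftrightarrow> conn C \<and> C \<subseteq> W \<and> anticomplete C (W - C)"

text \<open>Edges meeting \<open>S\<close> are exempt: they need not be isolated.\<close>

definition isolates :: "'a set \<Rightarrow> 'a set \<Rightarrow> 'a set \<Rightarrow> bool" where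
  "isolates W S X \<longleftrightarrow> X \<subseteq> W \<and>
     (\<forall>x\<in>W. \<forall>y\<in>W. E x y \<longrightarrow> x \<in> S \<union> X \<union> nbs X \<or> y \<in> S \<union> X \<union> nbs X)"

definition iso_num :: "'a set \<Rightarrow> 'a set \<Rightarrow> nat" where
  "iso_num W S = (LEAST m. \<exists>X. isolates W S X \<and> card X = m)"

definition isK2 :: "'a set \<Rightarrow> bool" where
  "isK2 C \<longleftrightarrow> (\<exists>p q. C = {p, q} \<and> E p q)"

definition isC5 :: "'a set \<Rightarrow> bool" where
  "isC5 C \<longleftrightarrow> (\<exists>a b c d e. C = {a, b, c, d, e} \<and> card C = 5 \<and>
     E a b \<and> E b c \<and> E c d \<and> E d e \<and> E e a \<and>
     \<not> E a c \<and> \<not> E a d \<and> \<not> E b d \<and> \<not> E b e \<and> \<not> E c e)"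

definition small :: "'a set \<Rightarrow> bool" where
  "small C \<longleftrightarrow> isK2 C \<or> isC5 C"

definition bad :: "'a set \<Rightarrow> 'a set \<Rightarrow> 'a set set" where
  "bad W S = {C. component C W \<and> small C \<and> C \<inter> S = {}}"

definition defect :: "'a set \<Rightarrow> 'a set \<Rightarrow> int" where
  "defect W S = int (card W) + int (card (bad W S)) - 3 * int (iso_num W S)"

section \<open>Connectivity and components\<close>

lemma nbs_empty [simp]: "nbs {} = {}"
  by (simp add: nbs_def)

lemma nbs_un: "nbs (A \<union> B) = nbs A \<union> nbs B"
  by (auto simp: nbs_def)

lemma connD: "conn W \<Longrightarrow> A \<subseteq> W \<Longrightarrow> A \<noteq> {} \<Longrightarrow> anticomplete A (W - A) \<Longrightarrow> A = W"
  unfolding conn_def by blast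

lemma conn_edge:
  assumes "conn W" "A \<subseteq> W" "A \<noteq> {}" "A \<noteq> W"
  obtains x y where "x \<in> A" "y \<in> W - A" "E x y"
  using assms unfolding conn_def anticomplete_def by blast

lemma conn_sub_component:
  assumes "conn A" "A \<subseteq> W" "component C W" "A \<inter> C \<noteq> {}"
  shows "A \<subseteq> C"
proof -
  have "anticomplete (A \<inter> C) (A - A \<inter> C)"
    using assms unfolding component_def anticomplete_def by blast
  from connD[OF assms(1) _ assms(4) this] show ?thesis by blast
qed

lemma component_unique:
  assumes "component C W" "component D W" "C \<inter> D \<noteq> {}"
  shows "C = D"
  using conn_sub_component[OF _ _ assms(2), of C] conn_sub_component[OF _ _ assms(1), of D] assms
  unfolding component_def by blast

text \<open>A smallest set that contains \<open>x\<close> and has no edge to the rest of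
  \<open>W\<close> is connected: a proper closed part of it, or the complement of that part, would
  be a smaller such set.\<close>

lemma component_exists:
  assumes "finite W" "x \<in> W"
  obtains C where "component C W" "x \<in> C"
proof -
  let ?P = "\<lambda>C. C \<subseteq> W \<and> x \<in> C \<and> anticomplete C (W - C)"
  have "?P W" using assms by (auto simp: anticomplete_def)
  then obtain C where C: "?P C" and min: "\<And>D. ?P D \<Longrightarrow> card C \<le> card D"
    using ex_has_least_nat[of ?P W card] by blast
  have fin: "finite C" using C assms(1) finite_subset by blast
  have "conn C"
    unfolding conn_def
  proof (intro conjI allI impI)
    show "C \<noteq> {}" using C by blast
    fix A assume A: "A \<subseteq> C" "A \<noteq> {}" "anticomplete A (C - A)"
    show "A = C"
    proof (cases "x \<in> A")
      case True
      have "?P A" using A C True unfolding anticomplete_def by blast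
      then show ?thesis using min[of A] A(1) fin by (simp add: card_seteq)
    next
      case False
      have "?P (C - A)" using A C False sym unfolding anticomplete_def by blast
      then have "card C \<le> card (C - A)" by (rule min)
      then have "C - A = C" using fin by (intro card_seteq) auto
      then show ?thesis using A by blast
    qed
  qed
  then show ?thesis using that C unfolding component_def by blast
qed

lemma component_self: "conn W \<Longrightarrow> component W W"
  by (simp add: component_def anticomplete_def)

lemma component_self_iff: "conn W \<Longrightarrow> component C W \<longleftrightarrow> C = W"
  using component_self component_unique[of C W W]
  by (metis Int_absorb2 component_def conn_def)

lemma component_ne: "component C W \<Longrightarrow> C \<noteq> {}"
  by (auto simp: component_def conn_def)

lemma component_sub: "component C W \<Longrightarrow> C \<subseteq> W"
  by (auto simp: component_def)

lemma component_anti: "component C W \<Longrightarrow> anticomplete C (W - C)"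
  by (auto simp: component_def)

lemma component_conn: "component C W \<Longrightarrow> conn C"
  by (auto simp: component_def)

lemma component_closed: "component C W \<Longrightarrow> x \<in> C \<Longrightarrow> E x y \<Longrightarrow> y \<in> W \<Longrightarrow> y \<in> C"
  unfolding component_def anticomplete_def by blast

lemma component_union_iff:
  assumes "anticomplete A B"
  shows "component C (A \<union> B) \<longleftrightarrow> component C A \<or> component C B"
proof
  assume C: "component C (A \<union> B)"
  have "C \<subseteq> A \<or> C \<subseteq> B"
  proof (rule ccontr)
    assume n: "\<not> ?thesis"
    have "C \<inter> A \<noteq> {}" using n component_sub[OF C] by blast
    moreover have "anticomplete (C \<inter> A) (C - C \<inter> A)"
      using assms component_sub[OF C] unfolding anticomplete_def by blast
    ultimately have "C \<inter> A = C" using connD[OF component_conn[OF C], of "C \<inter> A"] by blast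
    then show False using n by blast
  qed
  then show "component C A \<or> component C B"
    using C unfolding component_def anticomplete_def by blast
next
  assume "component C A \<or> component C B"
  then show "component C (A \<union> B)"
    using assms sym unfolding component_def anticomplete_def by blast
qed

text \<open>Some edge leaves \<open>C\<close> because \<open>W\<close> is connected, and it can only
  lead into \<open>T\<close>.\<close>

lemma component_union_hit:
  assumes "conn W" "component C (W - T)" "T \<subseteq> W" "T \<noteq> {}"
  shows "C \<inter> nbs T \<noteq> {}"
proof -
  have "C \<subseteq> W" "C \<noteq> W" "C \<noteq> {}"
    using component_sub[OF assms(2)] component_ne[OF assms(2)] assms(3,4) by auto
  then obtain x y where xy: "x \<in> C" "y \<in> W - C" "E x y"
    using conn_edge[OF assms(1)] by metis
  then have "y \<in> T" using component_closed[OF assms(2)] by blast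
  then show ?thesis using xy sym unfolding nbs_def by blast
qed

lemma conn_insert:
  assumes "conn C" "x \<in> C" "E x y"
  shows "conn (insert y C)"
  unfolding conn_def
proof (intro conjI allI impI)
  fix A assume A: "A \<subseteq> insert y C" "A \<noteq> {}" "anticomplete A (insert y C - A)"
  have 1: "A \<inter> C = C" if "A \<inter> C \<noteq> {}"
  proof -
    have "anticomplete (A \<inter> C) (C - A \<inter> C)" using A unfolding anticomplete_def by blast
    from connD[OF assms(1) _ that this] show ?thesis by blast
  qed
  show "A = insert y C"
  proof (cases "A \<inter> C = {}")
    case True
    then have "A = {y}" using A by blast
    then show ?thesis using A assms sym True unfolding anticomplete_def by blast
  next
    case False
    then have "C \<subseteq> A" using 1 by blast
    then show ?thesis using A assms unfolding anticomplete_def by blast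
  qed
qed simp

lemma conn_singleton [simp]: "conn {x}"
  unfolding conn_def by blast

section \<open>The graphs K2 and C5\<close>

lemma isK2_conn: "isK2 C \<Longrightarrow> conn C"
  unfolding isK2_def using conn_insert[of "{_}"] sym by (metis conn_singleton insert_iff)

lemma isC5_conn: "isC5 C \<Longrightarrow> conn C"
proof -
  assume "isC5 C"
  then obtain a b c d e where C: "C = {a,b,c,d,e}" "E a b" "E b c" "E c d" "E d e"
    unfolding isC5_def by blast
  have "conn {e}" by simp
  then have "conn {d,e}" using conn_insert[of "{e}" e d] C sym by simp
  then have "conn {c,d,e}" using conn_insert[of "{d,e}" d c] C sym by simp
  then have "conn {b,c,d,e}" using conn_insert[of "{c,d,e}" c b] C sym by simp
  then have "conn {a,b,c,d,e}" using conn_insert[of "{b,c,d,e}" b a] C sym by simp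
  then show ?thesis using C by simp
qed

lemma small_conn: "small C \<Longrightarrow> conn C"
  unfolding small_def using isK2_conn isC5_conn by blast

lemma isK2_card: "isK2 C \<Longrightarrow> card C = 2"
  unfolding isK2_def using irrefl by (metis card_2_iff)

lemma isC5_card: "isC5 C \<Longrightarrow> card C = 5"
  unfolding isC5_def by blast

lemma small_card: "small C \<Longrightarrow> card C = 2 \<or> card C = 5"
  unfolding small_def using isK2_card isC5_card by blast

lemma small_finite: "small C \<Longrightarrow> finite C"
  using small_card by (metis card.infinite zero_neq_numeral)

text \<open>Any vertex of the cycle may serve as its first one.\<close>

lemma isC5_rotate:
  assumes "isC5 C" "x \<in> C"
  obtains b c d e where "C = {x, b, c, d, e}" "distinct [x, b, c, d, e]"
    "E x b" "E b c" "E c d" "E d e" "E e x" "\<not> E x c" "\<not> E x d" "\<not> E b d" "\<not> E b e" "\<not> E c e"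
proof -
  from assms(1) obtain a b c d e where C: "C = {a, b, c, d, e}" "card C = 5"
    and e: "E a b" "E b c" "E c d" "E d e" "E e a"
    "\<not> E a c" "\<not> E a d" "\<not> E b d" "\<not> E b e" "\<not> E c e"
    unfolding isC5_def by blast
  have d: "distinct [a,b,c,d,e]" 
  proof (rule card_distinct)
    have "set [a,b,c,d,e] = C" using C(1) by simp
    then show "card (set [a,b,c,d,e]) = length [a,b,c,d,e]" using C(2) by (simp only:) simp
  qed
  have n': "\<not> E c a" "\<not> E d a" "\<not> E d b" "\<not> E e b" "\<not> E e c" using e sym by blast+
  consider "x = a" | "x = b" | "x = c" | "x = d" | "x = e" using assms(2) C(1) by blast
  then show ?thesis
  proof cases
    case 1 then show ?thesis using that[of b c d e] C d e by simp
  next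
    case 2 then show ?thesis using that[of c d e a] C d e n' by auto
  next
    case 3 then show ?thesis using that[of d e a b] C d e n' by auto
  next
    case 4 then show ?thesis using that[of e a b c] C d e n' by auto
  next
    case 5 then show ?thesis using that[of a b c d] C d e n' by auto
  qed
qed

section \<open>Combining isolating sets\<close>

lemma isolates_self: "isolates W S W"
  by (auto simp: isolates_def)

lemma iso_num_le: "isolates W S X \<Longrightarrow> iso_num W S \<le> card X"
  unfolding iso_num_def by (rule Least_le) blast

lemma iso_num_ex:
  obtains X where "isolates W S X" "card X = iso_num W S"
proof -
  have "\<exists>m. \<exists>X. isolates W S X \<and> card X = m" using isolates_self by blast
  from LeastI_ex[OF this] that show ?thesis unfolding iso_num_def by blast
qed

lemma iso_num_empty [simp]: "iso_num {} S = 0"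
  using iso_num_le[OF isolates_self[of "{}" S]] by simp

text \<open>The estimate behind the reductions: \<open>Y\<close> is paid for and \<open>T\<close> is
  deleted. Edges meeting \<open>T\<close> are dominated by \<open>Y\<close> or exempt, and the
  vertices that \<open>S'\<close> exempts are dominated by \<open>Y\<close> or were exempt
  before.\<close>

lemma iso_num_combine:
  assumes "finite W" "Y \<subseteq> T" "T \<subseteq> W" "T \<subseteq> Y \<union> nbs Y \<union> S" "W \<inter> S' \<subseteq> Y \<union> nbs Y \<union> S"
  shows "iso_num W S \<le> card Y + iso_num (W - T) S'"
proof -
  obtain X where X: "isolates (W - T) S' X" "card X = iso_num (W - T) S'" by (rule iso_num_ex)
  have "isolates W S (Y \<union> X)"
    using X(1) assms unfolding isolates_def nbs_un by blast
  then have "iso_num W S \<le> card (Y \<union> X)" by (rule iso_num_le)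
  also have "\<dots> \<le> card Y + card X" by (rule card_Un_le)
  finally show ?thesis using X by simp
qed

lemma iso_num_union:
  assumes "anticomplete A B"
  shows "iso_num (A \<union> B) S \<le> iso_num A S + iso_num B S"
proof -
  obtain X where X: "isolates A S X" "card X = iso_num A S" by (rule iso_num_ex)
  obtain Y where Y: "isolates B S Y" "card Y = iso_num B S" by (rule iso_num_ex)
  have "isolates (A \<union> B) S (X \<union> Y)"
    using X(1) Y(1) assms sym unfolding isolates_def nbs_un anticomplete_def by blast
  then have "iso_num (A \<union> B) S \<le> card (X \<union> Y)" by (rule iso_num_le)
  also have "\<dots> \<le> card X + card Y" by (rule card_Un_le)
  finally show ?thesis using X Y by simp
qed

section \<open>Superadditivity of the defect\<close>

lemma bad_union:
  assumes "anticomplete A B"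
  shows "bad (A \<union> B) S = bad A S \<union> bad B S"
  using component_union_iff[OF assms] unfolding bad_def by blast

lemma finite_bad: "finite W \<Longrightarrow> finite (bad W S)"
  by (rule finite_subset[of _ "Pow W"]) (auto simp: bad_def component_def)

lemma bad_disjoint: "A \<inter> B = {} \<Longrightarrow> bad A S \<inter> bad B S = {}"
  using component_ne component_sub unfolding bad_def by fastforce

text \<open>Orders and bad components add up exactly, while isolation numbers are
  subadditive.\<close>

lemma defect_union:
  assumes "finite A" "finite B" "A \<inter> B = {}" "anticomplete A B"
  shows "defect A S + defect B S \<le> defect (A \<union> B) S"
proof -
  have "card (bad (A \<union> B) S) = card (bad A S) + card (bad B S)"
    using assms by (simp add: bad_union card_Un_disjoint finite_bad bad_disjoint)
  moreover have "card (A \<union> B) = card A + card B" using assms by (simp add: card_Un_disjoint)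
  ultimately show ?thesis
    using iso_num_union[OF assms(4), of S] unfolding defect_def by linarith
qed

lemma defect_closed:
  assumes "finite W" "C \<subseteq> W" "anticomplete C (W - C)"
  shows "defect C S + defect (W - C) S \<le> defect W S"
proof -
  have "C \<union> (W - C) = W" using assms(2) by blast
  then show ?thesis
    using defect_union[of C "W - C" S] assms finite_subset[OF assms(2,1)] by auto
qed

lemma component_Diff:
  assumes "component C W" "component D W" "C \<noteq> D"
  shows "component D (W - C)"
proof -
  have "C \<inter> D = {}" using component_unique assms by blast
  then show ?thesis using assms(2) unfolding component_def anticomplete_def by blast
qed

text \<open>Components are split off one by one. Nonnegativity is a hypothesis because the estimate
  is also used inside the induction that proves it.\<close>

lemma sum_defect_le:
  assumes "finite W" "finite \<C>" "\<And>C. C \<in> \<C> \<Longrightarrow> component C W"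
    and nonneg: "\<And>W'. W' \<subseteq> W \<Longrightarrow> 0 \<le> defect W' S"
  shows "(\<Sum>C\<in>\<C>. defect C S) \<le> defect W S"
  using assms(2,1,3,4)
proof (induction \<C> arbitrary: W rule: finite_induct)
  case empty then show ?case by simp
next
  case (insert C \<C>)
  have C: "component C W" using insert by simp
  have "(\<Sum>C\<in>\<C>. defect C S) \<le> defect (W - C) S"
  proof (rule insert.IH)
    fix D assume "D \<in> \<C>"
    then show "component D (W - C)" using insert component_Diff[OF C, of D] by auto
  next
    show "0 \<le> defect W' S" if "W' \<subseteq> W - C" for W'
      using insert.prems(3)[of W'] that by blast
  qed (use insert.prems(1) in auto)
  moreover have "defect C S + defect (W - C) S \<le> defect W S"
    using C insert.prems(1) by (intro defect_closed) (auto simp: component_def)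
  ultimately show ?case using insert by simp
qed

lemma bad_empty_if_conn_hit: "conn W \<Longrightarrow> W \<inter> S \<noteq> {} \<Longrightarrow> bad W S = {}"
  using component_self_iff unfolding bad_def by auto

section \<open>Small components that meet the exempt set\<close>

lemma isK2_hit_defect:
  assumes "isK2 C" "C \<inter> S \<noteq> {}"
  shows "defect C S = 2"
proof -
  have "isolates C S {}" using assms irrefl unfolding isolates_def isK2_def by auto
  then have "iso_num C S = 0" using iso_num_le by fastforce
  then show ?thesis
    using assms by (simp add: defect_def isK2_card bad_empty_if_conn_hit isK2_conn)
qed

lemma isC5_hit_iso_num:
  assumes "isC5 C" "C \<inter> S \<noteq> {}"
  shows "iso_num C S \<le> 1"
proof -
  obtain x where x: "x \<in> C" "x \<in> S" using assms by blast
  obtain b c d e where C: "C = {x, b, c, d, e}" 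
    "E x b" "E b c" "E c d" "E d e" "E e x" "\<not> E b d" "\<not> E b e" "\<not> E c e"
    using isC5_rotate[OF assms(1) x(1)] by metis
  \<comment> \<open>With \<open>x\<close> exempt, only the edges \<open>b c\<close>,
    \<open>c d\<close> and \<open>d e\<close> are left, and \<open>c\<close> dominates
    \<open>b\<close> and \<open>d\<close>.\<close>
  have "isolates C S {c}"
    unfolding isolates_def nbs_def using C x irrefl sym by blast
  then show ?thesis using iso_num_le by fastforce
qed

text \<open>An exempt vertex lowers the isolation number to 0 for K2 and to at most 1 for C5, so the
  defect is 2 - 0 or at least 5 - 3.\<close>

lemma small_hit_defect:
  assumes "small C" "C \<inter> S \<noteq> {}"
  shows "2 \<le> defect C S"
proof (cases "isK2 C")
  case True
  then show ?thesis using isK2_hit_defect[OF _ assms(2)] by simp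
next
  case False
  then have "isC5 C" using assms by (simp add: small_def)
  then show ?thesis
    using isC5_hit_iso_num[of C S] assms(2)
    by (simp add: defect_def isC5_card bad_empty_if_conn_hit isC5_conn)
qed

end

section \<open>The one-third bound\<close>

text \<open>If a point lies in two of the sets, choosing it removes one point and at least two sets,
  which pays for 3. Otherwise the sets are disjoint, so \<open>2 * card \<C> \<le> card M\<close>,
  and one point from each set is enough.\<close>

lemma transversal_bound:
  fixes L :: "'b \<Rightarrow> 'c set"
  assumes "finite \<C>" "finite M" "\<And>C. C \<in> \<C> \<Longrightarrow> L C \<subseteq> M \<and> 2 \<le> card (L C)"
  shows "\<exists>U\<subseteq>M. (\<forall>C\<in>\<C>. U \<inter> L C \<noteq> {}) \<and> 3 * card U \<le> card M + card \<C>"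
  using assms
proof (induction "card M" arbitrary: M \<C>)
  case 0
  then have "M = {}" by simp
  then have "\<C> = {}" using 0(4) by fastforce
  then show ?case by auto
next
  case (Suc m)
  show ?case
  proof (cases "\<exists>x\<in>M. 2 \<le> card {C\<in>\<C>. x \<in> L C}")
    case True
    then obtain x where x: "x \<in> M" "2 \<le> card {C\<in>\<C>. x \<in> L C}" by blast
    let ?D = "{C\<in>\<C>. x \<notin> L C}"
    have "\<exists>U\<subseteq>M - {x}. (\<forall>C\<in>?D. U \<inter> L C \<noteq> {}) \<and> 3 * card U \<le> card (M - {x}) + card ?D"
    proof (rule Suc.hyps(1))
      show "m = card (M - {x})" using Suc x by simp
      show "finite ?D" "finite (M - {x})" using Suc by auto
      show "L C \<subseteq> M - {x} \<and> 2 \<le> card (L C)" if "C \<in> ?D" for C using Suc(5) that by blast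
    qed
    then obtain U where U: "U \<subseteq> M - {x}" "\<forall>C\<in>?D. U \<inter> L C \<noteq> {}"
      "3 * card U \<le> card (M - {x}) + card ?D" by blast
    have "card \<C> = card {C\<in>\<C>. x \<in> L C} + card ?D"
    proof -
      have "\<C> = {C\<in>\<C>. x \<in> L C} \<union> ?D" by blast
      then have "card \<C> = card ({C\<in>\<C>. x \<in> L C} \<union> ?D)" by simp
      also have "\<dots> = card {C\<in>\<C>. x \<in> L C} + card ?D"
        using Suc(3) by (intro card_Un_disjoint) auto
      finally show ?thesis .
    qed
    moreover have "card M = Suc (card (M - {x}))" using card.remove[OF Suc(4) x(1)] by simp
    moreover have "card (insert x U) \<le> Suc (card U)" using card_insert_if[of U x] by (cases "finite U") auto
    ultimately have "3 * card (insert x U) \<le> card M + card \<C>" using U x by linarith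
    then show ?thesis using U x(1) by (intro exI[of _ "insert x U"]) auto
  next
    case False
    have "disjoint_family_on L \<C>"
      unfolding disjoint_family_on_def
    proof (intro ballI impI, rule ccontr)
      fix C D assume CD: "C \<in> \<C>" "D \<in> \<C>" "C \<noteq> D" "L C \<inter> L D \<noteq> {}"
      then obtain x where x: "x \<in> L C" "x \<in> L D" by blast
      have "card {C, D} \<le> card {C\<in>\<C>. x \<in> L C}"
        using Suc(3) x CD by (intro card_mono) auto
      moreover have "x \<in> M" using x Suc(5)[OF CD(1)] by blast
      ultimately show False using False CD(3) by force
    qed
    then have "card (\<Union>C\<in>\<C>. L C) = (\<Sum>C\<in>\<C>. card (L C))"
      using Suc(3,4,5) by (intro card_UN_disjoint') (auto intro: finite_subset)
    moreover have "(\<Sum>C\<in>\<C>. card (L C)) \<ge> (\<Sum>C\<in>\<C>. 2)" using Suc(5) by (intro sum_mono) auto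
    moreover have "card (\<Union>C\<in>\<C>. L C) \<le> card M" using Suc(4,5) by (intro card_mono) auto
    ultimately have 1: "2 * card \<C> \<le> card M" by simp
    have "\<exists>f. \<forall>C\<in>\<C>. f C \<in> L C"
    proof (rule bchoice, rule ballI)
      fix C assume "C \<in> \<C>"
      then have "L C \<noteq> {}" using Suc(5)[of C] by auto
      then show "\<exists>y. y \<in> L C" by blast
    qed
    then obtain f where f: "\<forall>C\<in>\<C>. f C \<in> L C" by blast
    have "card (f ` \<C>) \<le> card \<C>" using Suc(3) by (rule card_image_le)
    then show ?thesis using 1 f Suc(5) by (intro exI[of _ "f ` \<C>"]) auto
  qed
qed

context ugraph
begin

section \<open>Isolating with a vertex and some of its neighbours\<close>

definition deg :: "'a set \<Rightarrow> 'a \<Rightarrow> nat" where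
  "deg W v = card (nbs {v} \<inter> W)"

definition rest :: "'a set \<Rightarrow> 'a \<Rightarrow> 'a set" where
  "rest W v = W - insert v (nbs {v})"

definition pendant_free :: "'a set \<Rightarrow> bool" where
  "pendant_free W \<longleftrightarrow> (\<forall>h\<in>W. bad (W - {h}) {} = {})"

lemma nbs_single [simp]: "x \<in> nbs {v} \<longleftrightarrow> E v x"
  by (simp add: nbs_def)

lemma rest_card:
  assumes "finite W" "v \<in> W"
  shows "card W = card (rest W v) + deg W v + 1"
proof -
  have "W = rest W v \<union> insert v (nbs {v} \<inter> W)" using assms by (auto simp: rest_def)
  moreover have "card (rest W v \<union> insert v (nbs {v} \<inter> W)) = card (rest W v) + card (insert v (nbs {v} \<inter> W))"
    using assms by (intro card_Un_disjoint) (auto simp: rest_def)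
  ultimately show ?thesis using assms irrefl by (simp add: deg_def)
qed

text \<open>Puts \<open>v\<close> and \<open>U\<close> into the isolating set, deletes the closed
  neighbourhood of \<open>v\<close> and exempts the neighbours of \<open>U\<close>. The last summand
  on the left counts the components that thereby cease to be bad; the constant 2 is the price 3 of
  \<open>v\<close> minus its own contribution to the order.\<close>

lemma defect_hit_rest_le:
  assumes fin: "finite W" and v: "v \<in> W" and U: "U \<subseteq> nbs {v} \<inter> W"
  shows "3 * int (iso_num W {}) + int (deg W v) + defect (rest W v) (nbs U)
      + int (card {C \<in> bad (rest W v) {}. C \<inter> nbs U \<noteq> {}})
    \<le> int (card W) + 2 + 3 * int (card U) + int (card (bad (rest W v) {}))"
proof -
  let ?R = "rest W v" and ?B = "bad (rest W v) {}"
  let ?T = "insert v (nbs {v} \<inter> W)"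
  have finU: "finite U" using U fin finite_subset by blast
  have "iso_num W {} \<le> card (insert v U) + iso_num (W - ?T) (nbs U)"
    using U v fin by (intro iso_num_combine) (auto simp: nbs_def)
  also have "W - ?T = ?R" by (auto simp: rest_def)
  finally have 1: "iso_num W {} \<le> 1 + card U + iso_num ?R (nbs U)"
    using card_insert_le_m1[of _ U v] finU by (cases "v \<in> U") (auto simp: insert_absorb)
  have "bad ?R (nbs U) = ?B - {C \<in> ?B. C \<inter> nbs U \<noteq> {}}" by (auto simp: bad_def)
  moreover have "finite ?R" using fin by (simp add: rest_def)
  ultimately have "card (bad ?R (nbs U)) + card {C \<in> ?B. C \<inter> nbs U \<noteq> {}} = card ?B"
    using finite_bad[of ?R "{}"]
    by (metis (no_types, lifting) Diff_partition add.commute card_Diff_subset card_mono finite_subset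
        le_add_diff_inverse mem_Collect_eq subsetI)
  then show ?thesis using 1 rest_card[OF fin v] unfolding defect_def by linarith
qed

lemma bad_hit_defect_sum:
  assumes fin: "finite W" and nonneg: "\<And>W'. W' \<subseteq> W \<Longrightarrow> 0 \<le> defect W' S"
    and B: "\<B> \<subseteq> {C \<in> bad W {}. C \<inter> S \<noteq> {}}"
  shows "2 * int (card \<B>) \<le> defect W S"
proof -
  have "finite \<B>" using finite_subset[OF B] finite_bad[OF fin] by simp
  have "2 * int (card \<B>) = (\<Sum>C\<in>\<B>. 2)" by simp
  also have "\<dots> \<le> (\<Sum>C\<in>\<B>. defect C S)"
    using B by (intro sum_mono small_hit_defect) (auto simp: bad_def)
  also have "\<dots> \<le> defect W S"
    using B \<open>finite \<B>\<close> fin nonneg by (intro sum_defect_le) (auto simp: bad_def)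
  finally show ?thesis .
qed

text \<open>Each bad component hit by \<open>U\<close> gains three: one by no longer being bad, two
  by its defect.\<close>

lemma neighborhood_inequality:
  assumes "finite W" "v \<in> W" "U \<subseteq> nbs {v} \<inter> W"
    and "\<And>W' S. W' \<subseteq> rest W v \<Longrightarrow> 0 \<le> defect W' S"
  shows "3 * iso_num W {} + deg W v + 3 * card {C \<in> bad (rest W v) {}. C \<inter> nbs U \<noteq> {}}
    \<le> card W + 2 + 3 * card U + card (bad (rest W v) {})"
proof -
  have "2 * int (card {C \<in> bad (rest W v) {}. C \<inter> nbs U \<noteq> {}}) \<le> defect (rest W v) (nbs U)"
    using assms by (intro bad_hit_defect_sum) (auto simp: rest_def)
  then show ?thesis using defect_hit_rest_le[OF assms(1-3)] by linarith
qed

text \<open>For a component \<open>C\<close> of \<open>rest W v\<close> this is its whole boundary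
  in \<open>W\<close>.\<close>

definition links :: "'a set \<Rightarrow> 'a \<Rightarrow> 'a set \<Rightarrow> 'a set" where
  "links W v C = {a \<in> nbs {v} \<inter> W. C \<inter> nbs {a} \<noteq> {}}"

lemma component_rest_closed:
  assumes "component C (rest W v)" "x \<in> C" "E x y" "y \<in> W"
  shows "y \<in> C \<or> y \<in> links W v C"
proof (cases "y \<in> rest W v")
  case True
  then show ?thesis using component_closed[OF assms(1-3)] by blast
next
  case False
  moreover have "y \<noteq> v" using assms component_sub[OF assms(1)] sym by (auto simp: rest_def)
  ultimately show ?thesis using assms sym by (auto simp: rest_def links_def)
qed

text \<open>All edges leaving \<open>C\<close> end in \<open>a\<close>, so deleting \<open>a\<close>
  cuts \<open>C\<close> off; at least one such edge exists because \<open>W\<close> is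
  connected.\<close>

lemma component_of_links_single:
  assumes "conn W" "component C (rest W v)" "v \<in> W" "links W v C \<subseteq> {a}" "a \<in> W"
  shows "component C (W - {a})" "links W v C = {a}"
proof -
  have sub: "C \<subseteq> W" "v \<notin> C" using component_sub[OF assms(2)] by (auto simp: rest_def)
  show 1: "links W v C = {a}"
  proof (rule ccontr)
    assume "links W v C \<noteq> {a}"
    then have "links W v C = {}" using assms(4) by blast
    then have "anticomplete C (W - C)"
      using component_rest_closed[OF assms(2)] unfolding anticomplete_def by blast
    then have "C = W" using connD[OF assms(1) sub(1) component_ne[OF assms(2)]] by blast
    then show False using sub assms(3) by blast
  qed
  have "a \<in> links W v C" using 1 by simp
  then have "a \<notin> C" using component_sub[OF assms(2)] by (auto simp: links_def rest_def)
  moreover have "anticomplete C (W - {a} - C)"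
    using component_rest_closed[OF assms(2)] 1 unfolding anticomplete_def by blast
  ultimately show "component C (W - {a})"
    using component_conn[OF assms(2)] sub unfolding component_def by blast
qed

text \<open>With a single link \<open>a\<close>, the component would be a pendant of the hook
  \<open>a\<close>.\<close>

lemma bad_links_card:
  assumes "finite W" "conn W" "pendant_free W" "v \<in> W" "C \<in> bad (rest W v) {}"
  shows "2 \<le> card (links W v C)"
proof (rule ccontr)
  assume n: "\<not> ?thesis"
  have fin: "finite (links W v C)" using assms(1) by (simp add: links_def)
  have C: "component C (rest W v)" "small C" using assms(5) by (auto simp: bad_def)
  show False
  proof (cases "links W v C = {}")
    case True
    \<comment> \<open>The empty set of links lies in \<open>{v}\<close>, and the lemma on single
      links would then make it equal to \<open>{v}\<close>.\<close>
    then have "links W v C \<subseteq> {v}" by simp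
    from component_of_links_single(2)[OF assms(2) C(1) assms(4) this assms(4)] True
    show False by simp
  next
    case False
    then have "card (links W v C) = 1" using n fin by (metis One_nat_def Suc_1 card_gt_0_iff less_2_cases not_less0 not_less)
    then obtain a where a: "links W v C = {a}" by (auto simp: card_1_singleton_iff)
    then have "a \<in> W" by (auto simp: links_def)
    then have "component C (W - {a})" using component_of_links_single[OF assms(2) C(1) assms(4)] a by blast
    then show False using assms(3) C \<open>a \<in> W\<close> unfolding pendant_free_def bad_def by blast
  qed
qed

lemma hit_iff_links:
  assumes "U \<subseteq> nbs {v} \<inter> W"
  shows "C \<inter> nbs U \<noteq> {} \<longleftrightarrow> U \<inter> links W v C \<noteq> {}"
  using assms unfolding links_def nbs_def by blast

lemma bad_transversal:
  assumes "finite W" "conn W" "pendant_free W" "v \<in> W"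
  obtains U where "U \<subseteq> nbs {v} \<inter> W" "\<And>C. C \<in> bad (rest W v) {} \<Longrightarrow> C \<inter> nbs U \<noteq> {}"
    "3 * card U \<le> deg W v + card (bad (rest W v) {})"
proof -
  have "\<exists>U\<subseteq>nbs {v} \<inter> W. (\<forall>C\<in>bad (rest W v) {}. U \<inter> links W v C \<noteq> {}) \<and>
    3 * card U \<le> card (nbs {v} \<inter> W) + card (bad (rest W v) {})"
    using assms bad_links_card[OF assms]
    by (intro transversal_bound) (auto simp: links_def rest_def intro: finite_bad)
  then show ?thesis using that hit_iff_links unfolding deg_def by metis
qed

text \<open>Otherwise the two ends of an edge have no further neighbours and are all of
  \<open>W\<close>.\<close>

lemma conn_two_nbs:
  assumes "finite W" "conn W" "3 \<le> card W"
  shows "\<exists>v\<in>W. 2 \<le> deg W v"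
proof (rule ccontr)
  assume n: "\<not> ?thesis"
  have lt: "deg W v \<le> 1" if "v \<in> W" for v using that n by force
  obtain v where v: "v \<in> W" using assms by (auto simp: conn_def)
  have "W \<noteq> {v}" using assms by auto
  then obtain a where a: "a \<in> W" "E v a" "a \<noteq> v" using conn_edge[OF assms(2), of "{v}"] v by auto
  have eq: "nbs {x} \<inter> W = {y}" if "x \<in> W" "y \<in> W" "E x y" for x y
  proof -
    have "{y} \<subseteq> nbs {x} \<inter> W" using that by auto
    moreover have "card (nbs {x} \<inter> W) \<le> card {y}" using lt[OF that(1)] by (simp add: deg_def)
    ultimately show ?thesis using assms(1) by (metis card_seteq finite_Int)
  qed
  have "anticomplete {v, a} (W - {v, a})"
    using eq[OF v a(1,2)] eq[OF a(1) v sym[OF a(2)]] unfolding anticomplete_def by auto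
  moreover have "{v, a} \<subseteq> W" using v a by simp
  ultimately have "{v, a} = W" using connD[OF assms(2), of "{v, a}"] by simp
  moreover have "card {v, a} \<le> 2" by (simp add: card_insert_if)
  ultimately have "card W \<le> 2" by simp
  then show False using assms(3) by simp
qed

section \<open>Isolating with a hook\<close>

text \<open>Paying 3 for \<open>s\<close> while the order drops by 1 leaves the budget 2.\<close>

lemma hook_inequality:
  assumes "finite W" "s \<in> W" "bad (W - {s}) (S \<union> nbs {s}) = {}"
  shows "3 * int (iso_num W S) + defect (W - {s}) (S \<union> nbs {s}) \<le> int (card W) + 2"
proof -
  have "iso_num W S \<le> card {s} + iso_num (W - {s}) (S \<union> nbs {s})"
    using assms by (intro iso_num_combine) auto
  moreover have "card W = Suc (card (W - {s}))" using card.remove[OF assms(1,2)] by simp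
  ultimately show ?thesis using assms(3) unfolding defect_def by simp
qed

text \<open>The budget 2 is used up by \<open>C\<close>, which has defect at least 2 once the
  neighbours of \<open>s\<close> are exempt.\<close>

lemma hook_defect:
  assumes "finite W" "s \<in> W" "bad (W - {s}) (S \<union> nbs {s}) = {}"
    and "C \<in> bad (W - {s}) S" "C \<inter> nbs {s} \<noteq> {}"
    and "\<And>W'. W' \<subseteq> W - {s} \<Longrightarrow> 0 \<le> defect W' (S \<union> nbs {s})"
  shows "3 * iso_num W S \<le> card W"
proof -
  have "2 \<le> defect C (S \<union> nbs {s})"
    using assms(4,5) by (intro small_hit_defect) (auto simp: bad_def)
  moreover have "defect C (S \<union> nbs {s}) + defect (W - {s} - C) (S \<union> nbs {s}) \<le> defect (W - {s}) (S \<union> nbs {s})"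
    using assms(1,4) by (intro defect_closed) (auto simp: bad_def component_def)
  moreover have "0 \<le> defect (W - {s} - C) (S \<union> nbs {s})" by (rule assms(6)) auto
  ultimately show ?thesis using hook_inequality[OF assms(1-3)] by linarith
qed

lemma isK2_iso_num: "isK2 C \<Longrightarrow> iso_num C S \<le> 1"
proof -
  assume "isK2 C"
  then obtain p q where "C = {p, q}" "E p q" unfolding isK2_def by blast
  then have "isolates C S {p}" using irrefl by (auto simp: isolates_def nbs_def)
  then show ?thesis using iso_num_le by fastforce
qed

lemma iso_num_exempt: "x \<in> W \<Longrightarrow> iso_num W S \<le> iso_num W (insert x S) + 1"
proof -
  assume x: "x \<in> W"
  obtain X where X: "isolates W (insert x S) X" "card X = iso_num W (insert x S)" by (rule iso_num_ex)
  have "isolates W S (insert x X)" using X(1) x unfolding isolates_def nbs_def by blast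
  then show ?thesis using iso_num_le X(2) card_insert_if[of X x]
    by (metis Suc_eq_plus1 card.infinite card_insert_le_m1 diff_Suc_1 finite_insert le_add2 le_trans order_refl zero_less_Suc)
qed

lemma isC5_iso_num: "isC5 C \<Longrightarrow> iso_num C S \<le> 2"
proof -
  assume C5: "isC5 C"
  then obtain x where x: "x \<in> C" using isC5_card by fastforce
  then have "iso_num C (insert x S) \<le> 1" using isC5_hit_iso_num[OF C5, of "insert x S"] by blast
  then show ?thesis using iso_num_exempt[OF x, of S] by linarith
qed

text \<open>A 5-cycle \<open>C\<close> would give its attachment vertex degree 3, so
  \<open>C\<close> is an edge. The degree bound forces the two neighbours of \<open>v\<close> to
  attach to different ends of it, which closes a 5-cycle with no further edges.\<close>

lemma cycle5_of_small_degrees: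
  assumes fin: "finite W" and W: "conn W" and d: "\<And>v. v \<in> W \<Longrightarrow> deg W v \<le> 2"
    and v: "v \<in> W" "deg W v = 2"
    and C: "C \<in> bad (rest W v) {}" "\<And>a. a \<in> nbs {v} \<inter> W \<Longrightarrow> C \<inter> nbs {a} \<noteq> {}"
  shows "isC5 W"
proof -
  \<comment> \<open>No vertex has three distinct neighbours; each configuration excluded below would
    create such a vertex.\<close>
  have le2: False if "x \<in> W" "{p, q, r} \<subseteq> W" "E x p" "E x q" "E x r" "distinct [p, q, r]" for x p q r
  proof -
    have "card {p, q, r} \<le> card (nbs {x} \<inter> W)" using that fin by (intro card_mono) auto
    then show False using d[OF that(1)] that(6) by (simp add: deg_def)
  qed
  obtain a b where ab: "nbs {v} \<inter> W = {a, b}" "a \<noteq> b"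
    using v(2) unfolding deg_def by (meson card_2_iff)
  have a: "a \<in> W" "E v a" "b \<in> W" "E v b" using ab by auto
  have Cc: "component C (rest W v)" "small C" using C by (auto simp: bad_def)
  have CW: "C \<subseteq> W" "v \<notin> C" "a \<notin> C" "b \<notin> C"
    using component_sub[OF Cc(1)] a by (auto simp: rest_def)
  obtain p where p: "p \<in> C" "E a p" using C(2)[of a] ab by auto
  obtain q where q: "q \<in> C" "E b q" using C(2)[of b] ab by auto
  have "isK2 C"
  proof (rule ccontr)
    assume "\<not> isK2 C"
    then have "isC5 C" using Cc by (simp add: small_def)
    from isC5_rotate[OF this p(1)] obtain x1 x2 x3 x4 where
      x: "C = {p, x1, x2, x3, x4}" "distinct [p, x1, x2, x3, x4]" "E p x1" "E x4 p" by metis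
    show False by (rule le2[of p a x1 x4]) (use x p a CW sym in auto)
  qed
  then obtain x where x: "C = {p, x}" "E p x" "p \<noteq> x"
    using p irrefl sym unfolding isK2_def by blast
  have "q \<noteq> p"
  proof
    assume "q = p"
    show False by (rule le2[of p a b x]) (use x p q \<open>q = p\<close> a ab CW sym in auto)
  qed
  then have qx: "q = x" using q x by blast
  have n: "\<not> E v x" "\<not> E v p"
    using component_sub[OF Cc(1)] x by (auto simp: rest_def)
  have nab: "\<not> E a b"
  proof
    assume "E a b"
    show False by (rule le2[of a v p b]) (use a p ab \<open>E a b\<close> CW n v sym irrefl in auto)
  qed
  have nax: "\<not> E a x"
  proof
    assume "E a x"
    show False by (rule le2[of a v p x]) (use a p ab \<open>E a x\<close> CW n x v sym irrefl in auto)
  qed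
  have nbp: "\<not> E b p"
  proof
    assume "E b p"
    show False by (rule le2[of b v p x]) (use a p q qx ab \<open>E b p\<close> CW n x v sym irrefl in auto)
  qed
  let ?V = "{v, a, p, x, b}"
  have dist: "distinct [v, a, p, x, b]" using CW x a ab irrefl by auto
  have sub: "?V \<subseteq> W" using v a CW x by auto
  have "anticomplete ?V (W - ?V)"
    unfolding anticomplete_def
  proof (intro ballI notI)
    fix y z assume y: "y \<in> ?V" and z: "z \<in> W - ?V" and e: "E y z"
    from y consider "y = v" | "y = a" | "y = p" | "y = x" | "y = b" by blast
    then show False
    proof cases
      case 1
      then have "z \<in> nbs {v} \<inter> W" using e z by simp
      then show False using z ab by blast
    next
      case 2 show False by (rule le2[of a v p z]) (use 2 e z a p CW v sym dist in auto)
    next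
      case 3 show False by (rule le2[of p a x z]) (use 3 e z a p x CW v sym dist in auto)
    next
      case 4 show False by (rule le2[of x p b z]) (use 4 e z a p q qx x CW v sym dist in auto)
    next
      case 5 show False by (rule le2[of b v x z]) (use 5 e z a p q qx x CW v sym dist in auto)
    qed
  qed
  then have "?V = W" using connD[OF W sub] by simp
  moreover have "card ?V = 5" using dist by simp
  moreover have "E v a" "E a p" "E p x" "E x b" "E b v" using a p x q qx sym by auto
  ultimately show ?thesis unfolding isC5_def using n nab nax nbp sym by metis
qed

section \<open>Induction for the one-third bound\<close>

text \<open>Strong induction on the order with \<open>S\<close> arbitrary. Disconnected sets split,
  an exempt vertex is deleted, small sets are computed, a pendant is peeled off. In the remaining
  case a negative defect forces at most one bad component outside each closed neighbourhood and
  degrees at most 2, hence a 5-cycle.\<close>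

theorem defect_nonneg: "finite W \<Longrightarrow> 0 \<le> defect W S"
proof (induction "card W" arbitrary: W S rule: less_induct)
  case less
  have IH: "0 \<le> defect W' S'" if "W' \<subset> W" for W' S'
    using less(1)[of W'] less(2) that by (meson finite_subset psubset_card_mono psubset_imp_subset)
  show ?case
  proof (cases "conn W")
    case False
    show ?thesis
    proof (cases "W = {}")
      case True then show ?thesis by (simp add: defect_def)
    next
      case ne: False
      then obtain A where A: "A \<subseteq> W" "A \<noteq> {}" "anticomplete A (W - A)" "A \<noteq> W"
        using False unfolding conn_def by blast
      have "0 \<le> defect A S" "0 \<le> defect (W - A) S" using A by (intro IH; blast)+
      then show ?thesis using defect_closed[OF less(2) A(1,3), of S] by linarith
    qed
  next
    case W: True
    \<comment> \<open>After deleting \<open>s\<close> every component contains a neighbour of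
      \<open>s\<close>, so exempting these leaves nothing bad.\<close>
    have hit: "bad (W - {s}) (S' \<union> nbs {s}) = {}" if "s \<in> W" for s S'
      using component_union_hit[OF W, of _ "{s}"] that unfolding bad_def by blast
    have hook: "0 \<le> defect W S" if "s \<in> W" "C \<in> bad (W - {s}) S" for s C
    proof -
      have "C \<inter> nbs {s} \<noteq> {}"
        using that component_union_hit[OF W, of C "{s}"] unfolding bad_def by blast
      moreover have "0 \<le> defect W' (S \<union> nbs {s})" if "W' \<subseteq> W - {s}" for W'
        using that \<open>s \<in> W\<close> by (intro IH) blast
      ultimately have "3 * iso_num W S \<le> card W"
        using hook_defect[OF less(2) that(1) hit[OF that(1)] that(2)] by blast
      then show ?thesis by (simp add: defect_def)
    qed
    show ?thesis
    proof (cases "W \<inter> S = {}")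
      case False
      then obtain s where s: "s \<in> W" "s \<in> S" by blast
      show ?thesis
      proof (cases "bad (W - {s}) S = {}")
        case True
        \<comment> \<open>All edges at the exempt vertex \<open>s\<close> are free, so
          \<open>s\<close> is deleted with nothing paid.\<close>
        have "iso_num W S \<le> iso_num (W - {s}) S"
          using iso_num_combine[OF less(2), of "{}" "{s}" S S] s by simp
        moreover have "0 \<le> defect (W - {s}) S" using s by (intro IH) blast
        moreover have "card W = Suc (card (W - {s}))" using card.remove[OF less(2) s(1)] by simp
        ultimately show ?thesis using True unfolding defect_def by simp
      next
        case False
        then show ?thesis using hook s by blast
      qed
    next
      case True
      \<comment> \<open>Since \<open>S\<close> misses \<open>W\<close>, it may be replaced by the
        empty set.\<close>
      then have S: "isolates W S X = isolates W {} X" for X unfolding isolates_def by blast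
      have S': "bad W' S = bad W' {}" if "W' \<subseteq> W" for W'
        using True that component_sub unfolding bad_def by blast
      have io: "iso_num W S = iso_num W {}" by (simp add: iso_num_def S)
      show ?thesis
      proof (cases "small W")
        case True
        then have "W \<in> bad W {}" using component_self[OF W] by (simp add: bad_def)
        then have "1 \<le> card (bad W {})"
          using finite_bad[OF less(2), of "{}"] by (metis One_nat_def Suc_leI card_gt_0_iff empty_iff)
        \<comment> \<open>The order plus 1 for \<open>W\<close> itself is 3 for K2 and 6 for C5,
          matching the bounds 1 and 2 on the isolation number.\<close>
        moreover have "3 * iso_num W {} \<le> card W + 1"
          using True isK2_iso_num[of W "{}"] isC5_iso_num[of W "{}"] isK2_card[of W] isC5_card[of W]
          unfolding small_def by auto
        ultimately show ?thesis using io S'[of W] by (simp add: defect_def)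
      next
        case ns: False
        show ?thesis
        proof (cases "pendant_free W")
          case False
          then obtain s C where "s \<in> W" "C \<in> bad (W - {s}) {}" unfolding pendant_free_def by blast
          then show ?thesis using hook S'[of "W - {s}"] by blast
        next
          case pf: True
          show ?thesis
          proof (rule ccontr)
            assume neg: "\<not> ?thesis"
            then have big: "card W + 1 \<le> 3 * iso_num W {}" using io by (simp add: defect_def)
            have ineq: "deg W v + 3 * card {C \<in> bad (rest W v) {}. C \<inter> nbs U \<noteq> {}}
                \<le> 1 + 3 * card U + card (bad (rest W v) {})"
              if "v \<in> W" "U \<subseteq> nbs {v} \<inter> W" for v U
            proof -
              have "0 \<le> defect W' S" if "W' \<subseteq> rest W v" for W' S
                using that \<open>v \<in> W\<close> by (intro IH) (auto simp: rest_def)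
              from neighborhood_inequality[OF less(2) that this] show ?thesis using big by linarith
            qed
            have b1: "card (bad (rest W v) {}) \<le> 1" if v: "v \<in> W" for v
            proof -
              \<comment> \<open>With a transversal as \<open>U\<close>, the degree cancels in
                \<open>ineq\<close> and at most one bad component is left.\<close>
              obtain U where U: "U \<subseteq> nbs {v} \<inter> W" "\<And>C. C \<in> bad (rest W v) {} \<Longrightarrow> C \<inter> nbs U \<noteq> {}"
                "3 * card U \<le> deg W v + card (bad (rest W v) {})"
                using bad_transversal[OF less(2) W pf v] by blast
              have "{C \<in> bad (rest W v) {}. C \<inter> nbs U \<noteq> {}} = bad (rest W v) {}" using U(2) by blast
              then show ?thesis using ineq[OF v U(1)] U(3) by simp
            qed
            have d: "deg W v \<le> 2" "deg W v \<le> 1 + card (bad (rest W v) {})" if v: "v \<in> W" for v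
              using ineq[OF v, of "{}"] b1[OF v] by auto
            have "3 \<le> card W"
            proof (rule ccontr)
              assume "\<not> ?thesis"
              moreover have "W \<noteq> {}" using W by (simp add: conn_def)
              then have "card W \<noteq> 0" using less(2) by simp
              ultimately consider "card W = 1" | "card W = 2" by linarith
              then show False
              proof cases
                case 1
                then obtain x where "W = {x}" by (auto simp: card_1_singleton_iff)
                then have "isolates W {} {}" using irrefl by (auto simp: isolates_def)
                then have "iso_num W {} = 0" using iso_num_le by fastforce
                then show False using big by simp
              next
                case 2
                then obtain x y where xy: "W = {x, y}" "x \<noteq> y" by (auto simp: card_2_iff)
                then have "E x y" using conn_edge[OF W, of "{x}"] by auto
                then show False using ns xy by (auto simp: small_def isK2_def)
              qed
            qed
            then obtain v where v: "v \<in> W" "2 \<le> deg W v" using conn_two_nbs[OF less(2) W] by blast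
            then have dv: "deg W v = 2" using d(1) by (simp add: le_antisym)
            then have "card (bad (rest W v) {}) = 1" using d(2)[OF v(1)] b1[OF v(1)] by simp
            then obtain C where C: "bad (rest W v) {} = {C}" by (auto simp: card_1_singleton_iff)
            \<comment> \<open>\<open>C\<close> has at least two links and \<open>v\<close> only two
              neighbours, so both neighbours are links.\<close>
            have "C \<inter> nbs {a} \<noteq> {}" if a: "a \<in> nbs {v} \<inter> W" for a
            proof -
              have fin: "finite (nbs {v} \<inter> W)" using less(2) by simp
              have "card (nbs {v} \<inter> W) \<le> card (links W v C)"
                using bad_links_card[OF less(2) W pf v(1), of C] C dv by (simp add: deg_def)
              then have "links W v C = nbs {v} \<inter> W"
                using fin by (intro card_seteq) (auto simp: links_def)
              then show ?thesis using a unfolding links_def by blast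
            qed
            then have "isC5 W"
              using cycle5_of_small_degrees[OF less(2) W d(1) v(1) dv] C by blast
            then show False using ns by (simp add: small_def)
          qed
        qed
      qed
    qed
  qed
qed

section \<open>Hooked graphs\<close>

text \<open>
  The condition on 5-cycles says that an edge of the pendant survives the removal of the neighbours of
  the hook. This excludes exactly the attachments that the family excludes.
\<close>

definition hooked :: "'a set \<Rightarrow> 'a set \<Rightarrow> ('a \<Rightarrow> 'a set) \<Rightarrow> bool" where
  "hooked W H P \<longleftrightarrow> W = H \<union> \<Union> (P ` H) \<and>
     (\<forall>h\<in>H. small (P h) \<and> P h \<inter> H = {} \<and> anticomplete (P h) (W - insert h (P h)) \<and>
        P h \<inter> nbs {h} \<noteq> {} \<and>
        (isC5 (P h) \<longrightarrow> (\<exists>x\<in>P h. \<exists>y\<in>P h. E x y \<and> \<not> E h x \<and> \<not> E h y))) \<and>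
     (\<forall>h\<in>H. \<forall>h'\<in>H. h \<noteq> h' \<longrightarrow> P h \<inter> P h' = {})"

section \<open>Peeling off hooks\<close>

text \<open>The neighbours of \<open>s\<close> in \<open>W'\<close> have to be hooks so that the old
  pendants receive no edge from \<open>s\<close>.\<close>

lemma hooked_extend:
  assumes h: "hooked W' H P" "nbs {s} \<inter> W' \<subseteq> H"
    and W: "W = insert s (C \<union> W')" "s \<notin> C" "s \<notin> W'" "C \<inter> W' = {}" "anticomplete C W'"
    and C: "small C" "C \<inter> nbs {s} \<noteq> {}"
      "isC5 C \<Longrightarrow> \<exists>x\<in>C. \<exists>y\<in>C. E x y \<and> \<not> E s x \<and> \<not> E s y"
  shows "hooked W (insert s H) (P(s := C))"
proof -
  note hd = h(1)[unfolded hooked_def]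
  have HW: "H \<subseteq> W'" "\<And>h. h \<in> H \<Longrightarrow> P h \<subseteq> W'" using hd by blast+
  have s: "s \<notin> H" using HW W by blast
  let ?P = "P(s := C)"
  have "small (?P h) \<and> ?P h \<inter> insert s H = {} \<and> anticomplete (?P h) (W - insert h (?P h)) \<and>
        ?P h \<inter> nbs {h} \<noteq> {} \<and>
        (isC5 (?P h) \<longrightarrow> (\<exists>x\<in>?P h. \<exists>y\<in>?P h. E x y \<and> \<not> E h x \<and> \<not> E h y))"
    if "h \<in> insert s H" for h
  proof (cases "h = s")
    case True
    have "C \<inter> insert s H = {}" using W HW by blast
    moreover have "anticomplete C (W - insert s C)" using W unfolding anticomplete_def by blast
    ultimately show ?thesis using True C by simp
  next
    case False
    then have hH: "h \<in> H" using that by blast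
    have Ph: "small (P h)" "P h \<inter> H = {}" "anticomplete (P h) (W' - insert h (P h))"
      "P h \<inter> nbs {h} \<noteq> {}"
      "isC5 (P h) \<longrightarrow> (\<exists>x\<in>P h. \<exists>y\<in>P h. E x y \<and> \<not> E h x \<and> \<not> E h y)"
      using hd hH by blast+
    have "anticomplete (P h) (W - insert h (P h))"
      unfolding anticomplete_def
    proof (intro ballI notI)
      fix x y assume x: "x \<in> P h" and y: "y \<in> W - insert h (P h)" and e: "E x y"
      have xW: "x \<in> W'" "x \<notin> H" using x HW(2)[OF hH] Ph(2) by blast+
      consider "y = s" | "y \<in> C" | "y \<in> W' - insert h (P h)" using y W(1) by blast
      then show False
      proof cases
        case 1
        then have "x \<in> nbs {s} \<inter> W'" using e sym xW by simp
        then show False using h(2) xW by blast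
      next
        case 2 then show False using W(5) xW e sym unfolding anticomplete_def by blast
      next
        case 3 then show False using Ph(3) x e unfolding anticomplete_def by blast
      qed
    qed
    moreover have "P h \<inter> insert s H = {}" using HW(2)[OF hH] W(3) Ph(2) by blast
    ultimately show ?thesis using Ph False by simp
  qed
  moreover have "W = insert s H \<union> \<Union> (?P ` insert s H)"
  proof -
    have "?P ` insert s H = insert C (P ` H)" using s by auto
    then show ?thesis using W(1) hd by auto
  qed
  moreover have "?P h \<inter> ?P h' = {}" if "h \<in> insert s H" "h' \<in> insert s H" "h \<noteq> h'" for h h'
  proof -
    have 1: "C \<inter> P k = {}" if "k \<in> H" for k using HW(2)[OF that] W(4) by blast
    have 2: "P k \<inter> P k' = {}" if "k \<in> H" "k' \<in> H" "k \<noteq> k'" for k k' using hd that by blast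
    show ?thesis using that 1[of h] 1[of h'] 2[of h h'] by (auto split: if_splits)
  qed
  ultimately show ?thesis unfolding hooked_def by blast
qed

text \<open>After paying for \<open>s\<close> the defect of \<open>W - {s}\<close> is at most 2. The
  pendant takes at least 2 of it, so the remaining part has defect 0 and \<open>C\<close> exactly 2.
  A 5-cycle in which every edge meets a neighbour of \<open>s\<close> would have defect at least
  5.\<close>

lemma hook_split:
  assumes fin: "finite W" and s: "s \<in> W"
    and C: "C \<in> bad (W - {s}) S" "C \<inter> nbs {s} \<noteq> {}"
    and hit: "\<And>D. component D (W - {s}) \<Longrightarrow> D \<inter> (S \<union> nbs {s}) \<noteq> {}"
    and tight: "card W \<le> 3 * iso_num W S"
  shows "defect (W - {s} - C) (S \<union> nbs {s}) = 0"
    and "isC5 C \<Longrightarrow> \<exists>x\<in>C. \<exists>y\<in>C. E x y \<and> \<not> E s x \<and> \<not> E s y"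
proof -
  let ?S = "S \<union> nbs {s}"
  have Cc: "component C (W - {s})" "small C" "C \<inter> S = {}" using C by (auto simp: bad_def)
  have "bad (W - {s}) ?S = {}" using hit unfolding bad_def by blast
  from hook_inequality[OF fin s this] have 1: "defect (W - {s}) ?S \<le> 2" using tight by linarith
  have 2: "defect C ?S + defect (W - {s} - C) ?S \<le> defect (W - {s}) ?S"
    using fin Cc by (intro defect_closed) (auto simp: component_def)
  have 3: "2 \<le> defect C ?S" using C Cc by (intro small_hit_defect) auto
  have 4: "0 \<le> defect (W - {s} - C) ?S" using fin by (intro defect_nonneg) auto
  show "defect (W - {s} - C) ?S = 0" using 1 2 3 4 by linarith
  assume C5: "isC5 C"
  show "\<exists>x\<in>C. \<exists>y\<in>C. E x y \<and> \<not> E s x \<and> \<not> E s y"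
  proof (rule ccontr)
    assume "\<not> ?thesis"
    then have "isolates C ?S {}" unfolding isolates_def by auto
    then have "iso_num C ?S = 0" using iso_num_le by fastforce
    then have "5 \<le> defect C ?S" using isC5_card[OF C5] by (simp add: defect_def)
    then show False using 1 2 4 by linarith
  qed
qed

text \<open>One hook with its pendant is split off. The induction hypothesis is an assumption, so
  that the step serves inside the induction of \<open>rooted_hooked\<close> and again after it with
  a prescribed hook and pendant.\<close>

lemma hooked_step:
  assumes fin: "finite W" and s: "s \<in> W"
    and C: "C \<in> bad (W - {s}) S" "C \<inter> nbs {s} \<noteq> {}"
    and hit: "\<And>D. component D (W - {s}) \<Longrightarrow> D \<inter> (S \<union> nbs {s}) \<noteq> {}"
    and tight: "card W \<le> 3 * iso_num W S"
    and IH: "\<lbrakk>defect (W - {s} - C) (S \<union> nbs {s}) = 0;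
        \<And>D. component D (W - {s} - C) \<Longrightarrow> D \<inter> (S \<union> nbs {s}) \<noteq> {}\<rbrakk>
      \<Longrightarrow> \<exists>H P. hooked (W - {s} - C) H P \<and> (W - {s} - C) \<inter> (S \<union> nbs {s}) \<subseteq> H"
  shows "\<exists>H P. hooked W H P \<and> W \<inter> S \<subseteq> H \<and> s \<in> H \<and> P s = C"
proof -
  let ?W = "W - {s} - C"
  have Cc: "component C (W - {s})" "small C" "C \<inter> S = {}" using C by (auto simp: bad_def)
  have CW: "C \<subseteq> W - {s}" using component_sub[OF Cc(1)] .
  have un: "W - {s} = C \<union> ?W" using CW by blast
  have anti: "anticomplete C ?W" using component_anti[OF Cc(1)] .
  have "\<exists>H P. hooked ?W H P \<and> ?W \<inter> (S \<union> nbs {s}) \<subseteq> H"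
  proof (rule IH)
    show "defect ?W (S \<union> nbs {s}) = 0" using hook_split(1)[OF fin s C hit tight] .
    fix D assume "component D ?W"
    then have "component D (W - {s})" using component_union_iff[OF anti] un by metis
    then show "D \<inter> (S \<union> nbs {s}) \<noteq> {}" by (rule hit)
  qed
  then obtain H P where H: "hooked ?W H P" "?W \<inter> (S \<union> nbs {s}) \<subseteq> H" by blast
  have "hooked W (insert s H) (P(s := C))"
  proof (rule hooked_extend[OF H(1)])
    show "W = insert s (C \<union> ?W)" using un s by blast
    show "isC5 C \<Longrightarrow> \<exists>x\<in>C. \<exists>y\<in>C. E x y \<and> \<not> E s x \<and> \<not> E s y"
      using hook_split(2)[OF fin s C hit tight] .
  qed (use H CW anti Cc C in auto)
  moreover have "W \<inter> S \<subseteq> insert s H" using H(2) Cc(3) by blast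
  ultimately show ?thesis by (intro exI[of _ "insert s H"] exI[of _ "P(s := C)"]) simp
qed

text \<open>A component of \<open>W - {s}\<close> without neighbours of \<open>s\<close> and without
  exempt vertices would already be a component of \<open>W\<close>.\<close>

lemma hit_after_deletion:
  assumes "\<And>D. component D W \<Longrightarrow> D \<inter> S \<noteq> {}" "component D (W - {s})"
  shows "D \<inter> (S \<union> nbs {s}) \<noteq> {}"
proof
  assume n: "D \<inter> (S \<union> nbs {s}) = {}"
  have "anticomplete D (W - D)"
    using n component_anti[OF assms(2)] sym unfolding anticomplete_def nbs_def by blast
  then have "component D W" using assms(2) unfolding component_def by blast
  then show False using assms(1) n by blast
qed

text \<open>The claim that exempt vertices are hooks drives the induction: the next round exempts
  the neighbours of \<open>s\<close>, and \<open>hooked_extend\<close> requires them to be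
  hooks.\<close>

theorem rooted_hooked:
  assumes "finite W" "defect W S = 0" "\<And>D. component D W \<Longrightarrow> D \<inter> S \<noteq> {}"
  shows "\<exists>H P. hooked W H P \<and> W \<inter> S \<subseteq> H"
  using assms
proof (induction "card W" arbitrary: W S rule: less_induct)
  case less
  show ?case
  proof (cases "W = {}")
    case True
    then show ?thesis by (auto simp: hooked_def)
  next
    case False
    then obtain D where "component D W" using component_exists[OF less(2)] by blast
    then obtain s where s: "s \<in> W" "s \<in> S" using less(4) component_sub by blast
    have bW: "bad W S = {}" using less(4) unfolding bad_def by blast
    have tight: "card W = 3 * iso_num W S" using less(3) bW by (simp add: defect_def)
    \<comment> \<open>Otherwise deleting \<open>s\<close> would lower the order by one but not the
      isolation number, against the one-third bound.\<close>
    have "bad (W - {s}) S \<noteq> {}"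
    proof
      assume "bad (W - {s}) S = {}"
      then have "3 * iso_num (W - {s}) S \<le> card (W - {s})"
        using defect_nonneg[of "W - {s}" S] less(2) by (simp add: defect_def)
      moreover have "iso_num W S \<le> iso_num (W - {s}) S"
        using iso_num_combine[OF less(2), of "{}" "{s}" S S] s by simp
      moreover have "card W = Suc (card (W - {s}))" using card.remove[OF less(2) s(1)] by simp
      ultimately show False using tight by linarith
    qed
    then obtain C where C: "C \<in> bad (W - {s}) S" by blast
    then have Cs: "C \<inter> nbs {s} \<noteq> {}"
      using hit_after_deletion[OF less(4), where D = C and s = s] unfolding bad_def by blast
    have "\<exists>H P. hooked W H P \<and> W \<inter> S \<subseteq> H \<and> s \<in> H \<and> P s = C"
    proof (rule hooked_step[OF less(2) s(1) C Cs hit_after_deletion[OF less(4)]])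
      show "card W \<le> 3 * iso_num W S" using tight by simp
      assume "defect (W - {s} - C) (S \<union> nbs {s}) = 0"
        "\<And>D. component D (W - {s} - C) \<Longrightarrow> D \<inter> (S \<union> nbs {s}) \<noteq> {}"
      then show "\<exists>H P. hooked (W - {s} - C) H P \<and> (W - {s} - C) \<inter> (S \<union> nbs {s}) \<subseteq> H"
        using less(2) s by (intro less(1)) (auto intro: psubset_card_mono)
    qed
    then show ?thesis by blast
  qed
qed

text \<open>Prescribes a hook and its pendant, which \<open>rooted_hooked\<close> leaves
  open.\<close>

lemma rooted_hooked_at:
  assumes fin: "finite W" and d: "defect W S = 0" and hit: "\<And>D. component D W \<Longrightarrow> D \<inter> S \<noteq> {}"
    and s: "s \<in> W" and C: "C \<in> bad (W - {s}) S"
  shows "\<exists>H P. hooked W H P \<and> W \<inter> S \<subseteq> H \<and> s \<in> H \<and> P s = C"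
proof (rule hooked_step[OF fin s C _ hit_after_deletion[OF hit]])
  show "C \<inter> nbs {s} \<noteq> {}"
    using hit_after_deletion[OF hit, where D = C and s = s] C unfolding bad_def by blast
  show "card W \<le> 3 * iso_num W S" using d by (simp add: defect_def)
qed (use fin rooted_hooked in auto)

text \<open>Nothing is exempt at the start. Paying for the first hook exempts its neighbours, and
  every component left by its deletion contains one of them.\<close>

theorem hooked_if_pendant:
  assumes fin: "finite W" and W: "conn W" and tight: "card W \<le> 3 * iso_num W {}"
    and s: "s \<in> W" and C: "C \<in> bad (W - {s}) {}"
  shows "\<exists>H P. hooked W H P"
proof -
  have hit: "D \<inter> nbs {s} \<noteq> {}" if "component D (W - {s})" for D
    using component_union_hit[OF W that] s by simp
  have "\<exists>H P. hooked W H P \<and> W \<inter> {} \<subseteq> H \<and> s \<in> H \<and> P s = C"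
  proof (rule hooked_step[OF fin s C _ _ tight])
    show "C \<inter> nbs {s} \<noteq> {}" using hit C by (simp add: bad_def)
  qed (use fin rooted_hooked hit in auto)
  then show ?thesis by blast
qed

section \<open>Connectivity of the hooks and savings on pendants\<close>

lemma hookedD:
  assumes "hooked W H P"
  shows "W = H \<union> \<Union> (P ` H)" "H \<subseteq> W" "h \<in> H \<Longrightarrow> P h \<subseteq> W" "h \<in> H \<Longrightarrow> small (P h)"
    "h \<in> H \<Longrightarrow> P h \<inter> H = {}" "h \<in> H \<Longrightarrow> anticomplete (P h) (W - insert h (P h))"
    "h \<in> H \<Longrightarrow> P h \<inter> nbs {h} \<noteq> {}"
    "h \<in> H \<Longrightarrow> h' \<in> H \<Longrightarrow> h \<noteq> h' \<Longrightarrow> P h \<inter> P h' = {}"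
  using assms unfolding hooked_def by blast+

text \<open>A set of hooks without edges to the other hooks, taken together with its pendants, has
  no edge to the rest of \<open>W\<close>.\<close>

lemma hooked_conn:
  assumes h: "hooked W H P" and W: "conn W"
  shows "conn H"
  unfolding conn_def
proof (intro conjI allI impI)
  note hd = hookedD[OF h]
  show "H \<noteq> {}" using W hd(1) by (auto simp: conn_def)
  fix A assume A: "A \<subseteq> H" "A \<noteq> {}" "anticomplete A (H - A)"
  let ?A = "A \<union> \<Union> (P ` A)"
  have "anticomplete ?A (W - ?A)"
    unfolding anticomplete_def
  proof (intro ballI notI)
    fix x y assume x: "x \<in> ?A" and y: "y \<in> W - ?A" and e: "E x y"
    show False
    proof (cases "x \<in> A")
      case True
      show False
      proof (cases "y \<in> H")
        case True then show False using \<open>x \<in> A\<close> A(3) y e unfolding anticomplete_def by blast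
      next
        case False
        then obtain h where hh: "h \<in> H" "y \<in> P h" using y hd(1) by blast
        then have "x \<notin> P h" "x \<in> W" using hd(2) hd(5)[of h] True A(1) by blast+
        moreover have "h \<noteq> x" using hh y \<open>x \<in> A\<close> by blast
        ultimately show False using hd(6)[OF hh(1)] hh(2) e sym unfolding anticomplete_def by blast
      qed
    next
      case False
      then obtain h where hh: "h \<in> A" "x \<in> P h" using x by blast
      then have "y \<in> W - insert h (P h)" using y by blast
      then show False using hd(6)[of h] hh A(1) e unfolding anticomplete_def by blast
    qed
  qed
  moreover have "?A \<subseteq> W" "?A \<noteq> {}" using A hd(1) by blast+
  ultimately have "?A = W" using connD[OF W] by blast
  then show "A = H" using A(1) hd(1) hd(5) by blast
qed

text \<open>
  If \<open>S\<close> meets all pendants, then a pendant on two vertices costs nothing and a 5-cycle costs one vertex,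
  so it suffices to dominate the hooks.
\<close>

lemma hooked_savings:
  assumes fin: "finite W" and h: "hooked W H P" and hit: "\<And>h. h \<in> H \<Longrightarrow> P h \<inter> S \<noteq> {}"
    and Z: "Z \<subseteq> H" "\<And>h. h \<in> H - Z \<Longrightarrow> \<exists>z\<in>Z. E z h"
  shows "3 * int (card H) - 3 * int (card Z) \<le> defect W S"
proof -
  note hd = hookedD[OF h]
  have finH: "finite H" using finite_subset[OF hd(2) fin] .
  have "\<forall>h\<in>H. \<exists>X. isolates (P h) S X \<and> 3 * card X + 2 \<le> card (P h)"
  proof
    fix h assume hH: "h \<in> H"
    obtain X where X: "isolates (P h) S X" "card X = iso_num (P h) S" by (rule iso_num_ex)
    \<comment> \<open>Defect at least 2 with nothing bad means that the order minus 2 covers three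
      times the isolation number of the pendant.\<close>
    have "2 \<le> defect (P h) S" using small_hit_defect[OF hd(4)[OF hH] hit[OF hH]] .
    moreover have "bad (P h) S = {}"
      using bad_empty_if_conn_hit[OF small_conn[OF hd(4)[OF hH]] hit[OF hH]] .
    ultimately show "\<exists>X. isolates (P h) S X \<and> 3 * card X + 2 \<le> card (P h)"
      using X by (intro exI[of _ X]) (simp add: defect_def)
  qed
  then obtain f where f: "\<And>h. h \<in> H \<Longrightarrow> isolates (P h) S (f h) \<and> 3 * card (f h) + 2 \<le> card (P h)"
    using bchoice by metis
  \<comment> \<open>\<open>Z\<close> takes care of all edges at hooks; every other edge lies inside
    one pendant, where \<open>f h\<close> and the exemption take care of it.\<close>
  let ?X = "Z \<union> (\<Union>h\<in>H. f h)"
  have "isolates W S ?X"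
    unfolding isolates_def
  proof (intro conjI ballI impI)
    show "?X \<subseteq> W" using Z hd(2,3) f unfolding isolates_def by blast
    have hooks: "x \<in> ?X \<union> nbs ?X" if "x \<in> H" for x
      using Z(2)[of x] that unfolding nbs_def by blast
    fix x y assume xy: "x \<in> W" "y \<in> W" "E x y"
    show "x \<in> S \<union> ?X \<union> nbs ?X \<or> y \<in> S \<union> ?X \<union> nbs ?X"
    proof (cases "x \<in> H \<or> y \<in> H")
      case True then show ?thesis using hooks by blast
    next
      case False
      then obtain h where hh: "h \<in> H" "x \<in> P h" using xy hd(1) by blast
      have "y \<in> P h"
        using hd(6)[OF hh(1)] hh xy False unfolding anticomplete_def by blast
      then have "x \<in> S \<union> f h \<union> nbs (f h) \<or> y \<in> S \<union> f h \<union> nbs (f h)"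
        using f[OF hh(1)] hh(2) xy(3) unfolding isolates_def by blast
      then show ?thesis using hh(1) unfolding nbs_def by blast
    qed
  qed
  then have 1: "iso_num W S \<le> card ?X" by (rule iso_num_le)
  have "card ?X \<le> card Z + card (\<Union>h\<in>H. f h)" by (rule card_Un_le)
  also have "card (\<Union>h\<in>H. f h) \<le> (\<Sum>h\<in>H. card (f h))" using finH by (rule card_UN_le)
  finally have "3 * card ?X \<le> 3 * card Z + (\<Sum>h\<in>H. 3 * card (f h))" by (simp add: sum_distrib_left[symmetric])
  moreover have "(\<Sum>h\<in>H. 3 * card (f h)) + (\<Sum>h\<in>H. 2) \<le> (\<Sum>h\<in>H. card (P h))"
    unfolding sum.distrib[symmetric] using f by (intro sum_mono) blast
  moreover have "card W = card H + (\<Sum>h\<in>H. card (P h))"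
  proof -
    have fP: "finite (P h)" if "h \<in> H" for h using hd(4)[OF that] small_finite by blast
    have "card W = card (H \<union> \<Union> (P ` H))" using hd(1) by simp
    also have "\<dots> = card H + card (\<Union> (P ` H))"
      using finH fP hd(5) by (intro card_Un_disjoint) auto
    also have "card (\<Union> (P ` H)) = (\<Sum>h\<in>H. card (P h))"
      using finH fP hd(8) by (intro card_UN_disjoint) auto
    finally show ?thesis .
  qed
  ultimately have "3 * card ?X + 3 * card H \<le> 3 * card Z + card W" by simp
  then show ?thesis using 1 unfolding defect_def by linarith
qed

text \<open>Dropping one of two adjacent hooks from the dominating set saves 3. With a third hook,
  connectivity of the hooks gives a hook \<open>u\<close> adjacent to two others, and dropping both
  saves 6.\<close>

lemma hooked_adjacent:
  assumes fin: "finite W" and W: "conn W" and h: "hooked W H P" and hit: "\<And>h. h \<in> H \<Longrightarrow> P h \<inter> S \<noteq> {}"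
    and xy: "x \<in> H" "y \<in> H" "E x y"
  shows "3 \<le> defect W S" "defect W S < 6 \<Longrightarrow> H = {x, y}"
proof -
  have finH: "finite H" using finite_subset[OF hookedD(2)[OF h] fin] .
  have ne: "x \<noteq> y" using xy irrefl by blast
  have "3 * int (card H) - 3 * int (card (H - {y})) \<le> defect W S"
    using xy ne by (intro hooked_savings[OF fin h hit]) auto
  moreover have "card H = Suc (card (H - {y}))" using card.remove[OF finH xy(2)] by simp
  ultimately show "3 \<le> defect W S" by simp
  show "H = {x, y}" if lt: "defect W S < 6"
  proof (rule ccontr)
    assume "H \<noteq> {x, y}"
    then obtain u z where uz: "u \<in> {x, y}" "z \<in> H - {x, y}" "E u z"
      using conn_edge[OF hooked_conn[OF h W], of "{x, y}"] xy by blast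
    obtain w where w: "{u, w} = {x, y}" "E u w" using uz(1) xy(3) sym by blast
    have uwz: "u \<in> H" "w \<in> H" "z \<in> H" "u \<noteq> w" "w \<noteq> z" "u \<noteq> z"
      using w uz xy ne by (auto simp: doubleton_eq_iff)
    have "3 * int (card H) - 3 * int (card (H - {w, z})) \<le> defect W S"
    proof (rule hooked_savings[OF fin h hit])
      show "\<exists>z'\<in>H - {w, z}. E z' h" if "h \<in> H - (H - {w, z})" for h
        using that uwz uz(3) w(2) by blast
    qed auto
    moreover have "card (H - {w, z}) = card H - card {w, z}"
      using uwz finH by (intro card_Diff_subset) auto
    moreover have "card {w, z} = 2" "card {w, z} \<le> card H"
      using uwz finH card_mono[OF finH, of "{w, z}"] by auto
    ultimately show False using lt by simp
  qed
qed

end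

section \<open>Graphs without pendants\<close>

text \<open>The case without pendants. What is derived here leads to the bound on the order in
  \<open>order_less_15\<close>.\<close>

locale tight_pendant_free = ugraph +
  fixes V :: "'a set"
  assumes fin: "finite V" and connV: "conn V" and pf: "pendant_free V"
    and tight: "card V = 3 * iso_num V {}"
begin

section \<open>Components left by the deletion of one vertex\<close>

text \<open>Otherwise \<open>P h\<close> would be a component of \<open>V - {h}\<close>, that is, a
  pendant of the whole graph.\<close>

lemma pendant_leaves:
  assumes h: "hooked W H P" "W \<subseteq> V" "h \<in> H"
  obtains x y where "x \<in> P h" "y \<in> V - W" "E x y"
proof (rule ccontr)
  assume n: "\<not> thesis"
  note hd = hookedD[OF h(1)]
  have hP: "h \<notin> P h" using hd(5)[OF h(3)] h(3) by blast
  have "anticomplete (P h) (V - {h} - P h)"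
    unfolding anticomplete_def
  proof (intro ballI notI)
    fix x y assume xy: "x \<in> P h" "y \<in> V - {h} - P h" "E x y"
    show False
    proof (cases "y \<in> W")
      case True then show False using hd(6)[OF h(3)] xy unfolding anticomplete_def by blast
    next
      case False then show False using n that xy by blast
    qed
  qed
  moreover have "P h \<subseteq> V - {h}" using hd(3)[OF h(3)] h(2) hP by blast
  ultimately have "P h \<in> bad (V - {h}) {}"
    using hd(4)[OF h(3)] small_conn unfolding bad_def component_def by blast
  moreover have "h \<in> V" using hd(2) h by blast
  ultimately show False using pf unfolding pendant_free_def by blast
qed

lemma component_of_deletion_hit: "component D (V - {h}) \<Longrightarrow> h \<in> V \<Longrightarrow> D \<inter> nbs {h} \<noteq> {}"
  using component_union_hit[OF connV, of D "{h}"] by simp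

lemma defect_mod3: "bad W S = {} \<Longrightarrow> defect W S mod 3 = int (card W) mod 3"
  by (simp add: defect_def mod_diff_eq[symmetric])

text \<open>With the neighbours of \<open>h\<close> exempt, the part of \<open>V - {h}\<close>
  outside \<open>D\<close> has defect 2 modulo 3, which uses up the whole budget 2. So
  \<open>D\<close> has defect 0 and is hooked, with the neighbours of \<open>h\<close> in
  \<open>D\<close> among the hooks. But a pendant in \<open>D\<close> must have an edge leaving
  \<open>D\<close>, and this can only end in \<open>h\<close>.\<close>

lemma no_component_mod3:
  assumes h: "h \<in> V" and D: "component D (V - {h})"
  shows "card D mod 3 \<noteq> 0"
proof
  assume m: "card D mod 3 = 0"
  let ?S = "nbs {h}" and ?R = "V - {h} - D"
  have anti: "anticomplete D ?R" using component_anti[OF D] .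
  have un: "V - {h} = D \<union> ?R" using component_sub[OF D] by blast
  have hit: "C \<inter> ?S \<noteq> {}" if "component C (V - {h})" for C
    using component_of_deletion_hit[OF that h] .
  have cD: "component C (V - {h})" if "component C D \<or> component C ?R" for C
    using that component_union_iff[OF anti] un by metis
  have bads: "bad (V - {h}) ?S = {}" "bad D ?S = {}" "bad ?R ?S = {}"
    using hit cD unfolding bad_def by blast+
  have "3 * int (iso_num V {}) + defect (V - {h}) ?S \<le> int (card V) + 2"
    using hook_inequality[OF fin h, of "{}"] bads(1) by simp
  then have 1: "defect (V - {h}) ?S \<le> 2" using tight by simp
  have 2: "defect D ?S + defect ?R ?S \<le> defect (V - {h}) ?S"
    using fin D by (intro defect_closed) (auto simp: component_def)
  have finD: "finite D" using component_sub[OF D] fin finite_subset by blast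
  have nn: "0 \<le> defect D ?S" "0 \<le> defect ?R ?S" using defect_nonneg fin finD by auto
  have "card V = Suc (card (V - {h}))" using card.remove[OF fin h] by simp
  also have "card (V - {h}) = card D + card ?R"
    using card_Un_disjoint[OF finD, of ?R] fin un by auto
  finally have c: "3 * iso_num V {} = Suc (card D + card ?R)" using tight by simp
  have "card ?R mod 3 = 2" using c m by presburger
  then have "defect ?R ?S mod 3 = 2" using defect_mod3[OF bads(3)] by presburger
  moreover have "defect D ?S mod 3 = 0" using defect_mod3[OF bads(2)] m by presburger
  ultimately have "defect D ?S = 0" using 1 2 nn by presburger
  then obtain H P where H: "hooked D H P" "D \<inter> ?S \<subseteq> H"
    using rooted_hooked[OF finD, of ?S] hit cD by blast
  have DV: "D \<subseteq> V" "h \<notin> D" using component_sub[OF D] by auto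
  obtain x where x: "x \<in> H" using H(2) hit[OF D] by blast
  obtain y z where yz: "y \<in> P x" "z \<in> V - D" "E y z"
    using pendant_leaves[OF H(1) DV(1) x] by blast
  have yD: "y \<in> D" "y \<notin> H" using hookedD(3,5)[OF H(1) x] yz(1) by blast+
  then have "z = h" using component_closed[OF D yD(1) yz(3)] yz(2) by blast
  then show False using H(2) yD yz(3) sym by auto
qed

section \<open>Bad components outside a closed neighbourhood\<close>

abbreviation R :: "'a \<Rightarrow> 'a set" where "R v \<equiv> rest V v"
abbreviation B :: "'a \<Rightarrow> 'a set set" where "B v \<equiv> bad (rest V v) {}"
abbreviation N :: "'a \<Rightarrow> 'a set" where "N v \<equiv> nbs {v} \<inter> V"
abbreviation lk :: "'a \<Rightarrow> 'a set \<Rightarrow> 'a set" where "lk v C \<equiv> links V v C"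

lemma finR: "finite (R v)" using fin by (simp add: rest_def)

text \<open>A single link would make \<open>C\<close> a component after the deletion of one vertex:
  a pendant if \<open>C\<close> is small, and otherwise a component of order divisible by 3.\<close>

lemma card_links_ge2:
  assumes v: "v \<in> V" and C: "component C (R v)" "small C \<or> card C mod 3 = 0"
  shows "2 \<le> card (lk v C)"
proof (cases "small C")
  case True
  then show ?thesis using bad_links_card[OF fin connV pf v, of C] C by (simp add: bad_def)
next
  case False
  then have m: "card C mod 3 = 0" using C by blast
  have single: False if "lk v C \<subseteq> {a}" "a \<in> V" for a
    using no_component_mod3[OF that(2) component_of_links_single(1)[OF connV C(1) v that]] m by simp
  have finl: "finite (lk v C)" using fin by (simp add: links_def)
  show ?thesis
  proof (rule ccontr)
    assume "\<not> ?thesis"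
    then have le1: "card (lk v C) \<le> Suc 0" by simp
    show False
    proof (cases "lk v C = {}")
      case True then show False using single[of v] v by simp
    next
      case False
      then obtain a where a: "a \<in> lk v C" by blast
      then have "lk v C \<subseteq> {a}" using le1 finl by (metis card_le_Suc0_iff_eq insertI1 subsetI singletonD)
      moreover have "a \<in> V" using a by (simp add: links_def)
      ultimately show False by (rule single)
    qed
  qed
qed

lemma neighborhood_tight:
  assumes "v \<in> V" "U \<subseteq> N v"
  shows "deg V v + 3 * card {C \<in> B v. C \<inter> nbs U \<noteq> {}} \<le> 2 + 3 * card U + card (B v)"
  using neighborhood_inequality[OF fin assms defect_nonneg[OF finite_subset[OF _ finR]]] tight
  by simp

text \<open>With a transversal as \<open>U\<close> in \<open>neighborhood_tight\<close>, the degree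
  cancels.\<close>

lemma card_B_le2:
  assumes v: "v \<in> V"
  shows "card (B v) \<le> 2"
proof -
  obtain U where U: "U \<subseteq> N v" "\<And>C. C \<in> B v \<Longrightarrow> C \<inter> nbs U \<noteq> {}" "3 * card U \<le> deg V v + card (B v)"
    using bad_transversal[OF fin connV pf v] by blast
  have "{C \<in> B v. C \<inter> nbs U \<noteq> {}} = B v" using U(2) by blast
  then show ?thesis using neighborhood_tight[OF v U(1)] U(3) by simp
qed

lemma deg_le: "v \<in> V \<Longrightarrow> deg V v \<le> 2 + card (B v)"
  using neighborhood_tight[of v "{}"] by simp

lemma finB: "finite (B v)"
  using finite_bad[OF finR] .

lemma lk_sub: "lk v C \<subseteq> N v"
  by (auto simp: links_def)

lemma finN: "finite (N v)"
  using fin by simp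

text \<open>A common link \<open>a\<close>, taken as the only element of \<open>U\<close>, hits two
  bad components at once, and the inequality then bounds the degree by 1.\<close>

lemma disjoint_links:
  assumes v: "v \<in> V" "3 \<le> deg V v" and C: "C \<in> B v" "D \<in> B v" "C \<noteq> D"
  shows "lk v C \<inter> lk v D = {}"
proof (rule ccontr)
  assume "lk v C \<inter> lk v D \<noteq> {}"
  then obtain a where a: "a \<in> lk v C" "a \<in> lk v D" by blast
  have "card {C, D} \<le> card {C \<in> B v. C \<inter> nbs {a} \<noteq> {}}"
    using a C finB by (intro card_mono) (auto simp: links_def)
  then show False
    using neighborhood_tight[OF v(1), of "{a}"] card_B_le2[OF v(1)] v(2) a C(3)
    by (auto simp: links_def)
qed

text \<open>Equality could fail only for degree 3 with two bad components, but their disjoint sets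
  of links need four neighbours.\<close>

lemma deg_le_card_B:
  assumes v: "v \<in> V" "3 \<le> deg V v"
  shows "deg V v = 2 + card (B v)"
proof (rule antisym)
  show "deg V v \<le> 2 + card (B v)" using deg_le[OF v(1)] .
  show "2 + card (B v) \<le> deg V v"
  proof (rule ccontr)
    assume n: "\<not> ?thesis"
    then have "card (B v) = 2" "deg V v = 3" using card_B_le2[OF v(1)] v(2) by linarith+
    then obtain C D where CD: "B v = {C, D}" "C \<noteq> D" by (auto simp: card_2_iff)
    then have CB: "C \<in> B v" "D \<in> B v" by auto
    have "card (lk v C \<union> lk v D) = card (lk v C) + card (lk v D)"
      using disjoint_links[OF v CB CD(2)] finite_subset[OF lk_sub finN] by (intro card_Un_disjoint)
    moreover have "2 \<le> card (lk v C)" "2 \<le> card (lk v D)"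
      using CB card_links_ge2[OF v(1)] by (auto simp: bad_def)
    moreover have "card (lk v C \<union> lk v D) \<le> deg V v"
      unfolding deg_def using lk_sub by (intro card_mono finN) blast
    ultimately show False using \<open>deg V v = 3\<close> by linarith
  qed
qed

lemma deg_le4: "v \<in> V \<Longrightarrow> deg V v \<le> 4"
  using deg_le card_B_le2 by fastforce

text \<open>Equality in the degree bound leaves defect 0 for \<open>R v\<close>, hence for each
  component. A component that is not bad then has order three times its isolation number.\<close>

lemma component_of_rest:
  assumes v: "v \<in> V" "3 \<le> deg V v" and C: "component C (R v)"
  shows "C \<in> B v \<or> card C mod 3 = 0"
proof (rule disjCI)
  assume "card C mod 3 \<noteq> 0"
  show "C \<in> B v"
  proof (rule ccontr)
    assume n: "C \<notin> B v"
    have "defect (R v) {} \<le> 0"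
      using defect_hit_rest_le[OF fin v(1), of "{}"] tight deg_le_card_B[OF v] by simp
    moreover have "defect C {} + defect (R v - C) {} \<le> defect (R v) {}"
      using C finR by (intro defect_closed) (auto simp: component_def)
    moreover have "finite C" using component_sub[OF C] finR finite_subset by blast
    then have "0 \<le> defect C {}" "0 \<le> defect (R v - C) {}" using defect_nonneg finR by auto
    ultimately have "defect C {} = 0" by linarith
    moreover have "bad C {} = {}"
      using n C component_self_iff[OF component_conn[OF C]] unfolding bad_def by auto
    ultimately have "card C = 3 * iso_num C {}" by (simp add: defect_def)
    then show False using \<open>card C mod 3 \<noteq> 0\<close> by simp
  qed
qed

lemma card_links_component:
  assumes "v \<in> V" "3 \<le> deg V v" "component C (R v)"
  shows "2 \<le> card (lk v C)"
  using card_links_ge2[OF assms(1,3)] component_of_rest[OF assms] by (auto simp: bad_def)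

text \<open>The condition on \<open>a\<close> and \<open>c\<close> ensures that \<open>G - {v, a, c}\<close> has no bad component avoiding \<open>N(v)\<close>.\<close>

definition good :: "'a \<Rightarrow> 'a \<Rightarrow> 'a \<Rightarrow> bool" where
  "good v a c \<longleftrightarrow> v \<in> V \<and> a \<in> N v \<and> c \<in> N v \<and> a \<noteq> c \<and> (\<forall>C\<in>B v. \<not> lk v C \<subseteq> {a, c})"

section \<open>Removing a vertex with two of its neighbours\<close>

text \<open>Paying for \<open>v\<close> removes \<open>v\<close>, \<open>a\<close> and
  \<open>c\<close> at no loss; paying for \<open>a\<close> and \<open>c\<close> removes the same
  three vertices and loses 3. A bad component left over would have all its links in
  \<open>{a, c}\<close> in the first case, against \<open>good\<close>, and would be a pendant of
  \<open>v\<close> in the second.\<close>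

lemma good_defects:
  assumes g: "good v a c"
  shows "defect (V - {v, a, c}) (nbs {v}) = 0"
    and "defect (V - {v, a, c}) (nbs {a, c}) \<le> 3"
proof -
  let ?F = "V - {v, a, c}"
  note gd = g[unfolded good_def]
  have ne: "v \<noteq> a" "v \<noteq> c" using gd irrefl by auto
  have finF: "finite ?F" using fin by simp
  have "card {v, a, c} = 3" using gd ne by simp
  moreover have "{v, a, c} \<subseteq> V" using gd by simp
  ultimately have cF: "card V = card ?F + 3"
    using card_Diff_subset[of "{v, a, c}" V] card_mono[OF fin, of "{v, a, c}"] by simp
  have "bad ?F (nbs {v}) = {}"
  proof (rule ccontr)
    assume "bad ?F (nbs {v}) \<noteq> {}"
    then obtain C where C: "component C ?F" "small C" "C \<inter> nbs {v} = {}" by (auto simp: bad_def)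
    have "component C (R v)"
      using C gd component_closed[OF C(1)] component_sub[OF C(1)] unfolding component_def rest_def anticomplete_def by blast
    then have "C \<in> B v" using C by (simp add: bad_def)
    then obtain y where y: "y \<in> lk v C" "y \<noteq> a" "y \<noteq> c" using gd by blast
    then obtain x where x: "x \<in> C" "E y x" "y \<in> V" "E v y" by (auto simp: links_def nbs_def)
    have "y \<in> C" using component_closed[OF C(1) x(1) sym[OF x(2)]] x y irrefl by auto
    then show False using C(3) x by auto
  qed
  moreover have "iso_num V {} \<le> 1 + iso_num ?F (nbs {v})"
    using iso_num_combine[OF fin, of "{v}" "{v, a, c}" "{}" "nbs {v}"] gd by auto
  ultimately have "defect ?F (nbs {v}) \<le> 0" using cF tight unfolding defect_def by simp
  then show "defect ?F (nbs {v}) = 0" using defect_nonneg[OF finF, of "nbs {v}"] by linarith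
  have "bad ?F (nbs {a, c}) = {}"
  proof (rule ccontr)
    assume "bad ?F (nbs {a, c}) \<noteq> {}"
    then obtain C where C: "component C ?F" "small C" "C \<inter> nbs {a, c} = {}" by (auto simp: bad_def)
    have "anticomplete C (V - {v} - C)"
      unfolding anticomplete_def
    proof (intro ballI notI)
      fix x y assume xy: "x \<in> C" "y \<in> V - {v} - C" "E x y"
      then have "y \<in> {a, c}" using component_closed[OF C(1)] by blast
      then show False using C(3) xy sym unfolding nbs_def by blast
    qed
    then have "C \<in> bad (V - {v}) {}"
      using C component_conn[OF C(1)] component_sub[OF C(1)] unfolding bad_def component_def by blast
    then show False using pf gd unfolding pendant_free_def by blast
  qed
  moreover have "iso_num V {} \<le> card {a, c} + iso_num ?F (nbs {a, c})"
    using gd sym by (intro iso_num_combine[OF fin]) (auto simp: nbs_def)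
  moreover have "card {a, c} = 2" using gd by simp
  ultimately show "defect ?F (nbs {a, c}) \<le> 3" using cF tight unfolding defect_def by simp
qed

text \<open>
  \<open>G - {v, a, c}\<close> is tight with \<open>N(v)\<close> exempt, so \<open>b\<close> is a hook with pendant \<open>P\<close>, and \<open>D\<close> contains a hook
  adjacent to \<open>b\<close>. With \<open>N(a)\<close> and \<open>N(c)\<close> exempt instead, the defect is at most 3, which leaves room for
  only two adjacent hooks.
\<close>

lemma adjacent_part:
  assumes g: "good v a c" and P: "P \<in> B v" "b \<in> lk v P" "lk v P \<subseteq> {a, b, c}" and b: "b \<noteq> a" "b \<noteq> c"
    and D: "component D (R v)" "D \<noteq> P" "b \<in> lk v D"
  obtains W where "component W (V - {v, a, c})" "W = insert b (P \<union> D)" "card D \<in> {3, 6}"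
    "3 \<le> defect W (nbs {a, c})"
proof -
  let ?F = "V - {v, a, c}" and ?S = "nbs {a, c}"
  note gd = g[unfolded good_def]
  have finF: "finite ?F" using fin by simp
  have bN: "b \<in> V" "E v b" using P(2) by (auto simp: links_def)
  then have bF: "b \<in> ?F" using b irrefl by auto
  obtain W where W: "component W ?F" "b \<in> W" using component_exists[OF finF bF] .
  have WF: "W \<subseteq> ?F" using component_sub[OF W(1)] .
  have finW: "finite W" using WF finF finite_subset by blast
  have connW: "conn W" using component_conn[OF W(1)] .
  have dW: "defect W X + defect (?F - W) X \<le> defect ?F X" for X
    using W finF by (intro defect_closed) (auto simp: component_def)
  have nn: "0 \<le> defect W X" "0 \<le> defect (?F - W) X" for X using defect_nonneg finW finF by auto
  have Pc: "component P (R v)" "small P" using P(1) by (auto simp: bad_def)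
  have RF: "R v \<subseteq> ?F" using gd by (auto simp: rest_def)
  have inW: "C \<subseteq> W" if C: "component C (R v)" "b \<in> lk v C" for C
  proof -
    obtain x where x: "x \<in> C" "E b x" using C(2) by (auto simp: links_def)
    have CF: "C \<subseteq> ?F" using component_sub[OF C(1)] RF by blast
    then have "x \<in> W" using component_closed[OF W(1) W(2) x(2)] x(1) by blast
    then show ?thesis using conn_sub_component[OF component_conn[OF C(1)] CF W(1)] x(1) by blast
  qed
  have PW: "P \<subseteq> W" and DW: "D \<subseteq> W" using inW Pc P D by auto
  have bPD: "b \<notin> P" "b \<notin> D" using component_sub[OF Pc(1)] component_sub[OF D(1)] bN by (auto simp: rest_def)
  \<comment> \<open>All links of \<open>P\<close> lie in \<open>{a, b, c}\<close>, so deleting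
    \<open>b\<close> as well cuts \<open>P\<close> off.\<close>
  have "P \<in> bad (W - {b}) (nbs {v})"
  proof -
    have "anticomplete P (W - {b} - P)"
      unfolding anticomplete_def
    proof (intro ballI notI)
      fix x y assume xy: "x \<in> P" "y \<in> W - {b} - P" "E x y"
      then have "y \<in> lk v P" using component_rest_closed[OF Pc(1)] WF by blast
      then show False using P(3) xy WF by blast
    qed
    then have "component P (W - {b})"
      using PW bPD component_conn[OF Pc(1)] unfolding component_def by blast
    then show ?thesis using Pc component_sub[OF Pc(1)] by (auto simp: bad_def rest_def)
  qed
  moreover have "defect W (nbs {v}) = 0" using dW[of "nbs {v}"] nn[of "nbs {v}"] good_defects(1)[OF g] by linarith
  moreover have "C \<inter> nbs {v} \<noteq> {}" if "component C W" for C
    using that component_self_iff[OF connW] W(2) bN by auto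
  ultimately obtain H Q where H: "hooked W H Q" "W \<inter> nbs {v} \<subseteq> H" "b \<in> H" "Q b = P"
    using rooted_hooked_at[OF finW _ _ W(2)] by metis
  note hd = hookedD[OF H(1)]
  \<comment> \<open>Every pendant has an edge leaving \<open>W\<close>, to \<open>v\<close>,
    \<open>a\<close> or \<open>c\<close>; the end \<open>v\<close> is impossible because the
    neighbours of \<open>v\<close> in \<open>W\<close> are hooks.\<close>
  have hit: "Q h \<inter> ?S \<noteq> {}" if h: "h \<in> H" for h
  proof -
    have "W \<subseteq> V" using WF by blast
    then obtain x y where xy: "x \<in> Q h" "y \<in> V - W" "E x y" using pendant_leaves[OF H(1) _ h] by blast
    have x: "x \<in> W" "x \<notin> H" using hd(3,5)[OF h] xy by blast+
    have "y \<in> {v, a, c}" using component_closed[OF W(1) x(1) xy(3)] xy(2) by blast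
    moreover have "y \<noteq> v" using H(2) x xy(3) sym by auto
    ultimately show ?thesis using xy sym by (auto simp: nbs_def)
  qed
  obtain t where t: "t \<in> D" "E b t" using D(3) by (auto simp: links_def)
  have DP: "D \<inter> P = {}" using component_unique[OF D(1) Pc(1)] D(2) by blast
  \<comment> \<open>Otherwise \<open>t\<close> would lie in a pendant whose hook is its neighbour
    \<open>b\<close>, that is, in \<open>P\<close>.\<close>
  have tH: "t \<in> H"
  proof (rule ccontr)
    assume "t \<notin> H"
    then obtain h where h: "h \<in> H" "t \<in> Q h" using t DW hd(1) by blast
    have "b \<notin> Q h" using hd(5)[OF h(1)] H(3) by blast
    then have "b = h" using hd(6)[OF h(1)] h(2) W(2) t(2) sym unfolding anticomplete_def by blast
    then show False using h H(4) DP t by blast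
  qed
  have dS: "defect W ?S \<le> 3" using dW[of ?S] nn[of ?S] good_defects(2)[OF g] by linarith
  have d3: "3 \<le> defect W ?S" using hooked_adjacent(1)[OF finW connW H(1) hit H(3) tH t(2)] .
  have H2: "H = {b, t}" using hooked_adjacent(2)[OF finW connW H(1) hit H(3) tH t(2)] dS by simp
  have bt: "b \<noteq> t" using t bPD by blast
  have Weq: "W = {b, t} \<union> P \<union> Q t" using hd(1) H2 H(4) by auto
  have "Q t \<subseteq> D"
  proof (rule conn_sub_component[THEN subset_trans])
    have "Q t \<inter> nbs {v} = {}" using H(2) hd(3,5)[OF tH] by blast
    moreover have "Q t \<subseteq> V - {v}" using hd(3)[OF tH] WF by blast
    ultimately show QR: "Q t \<subseteq> R v" by (auto simp: rest_def)
    obtain z where z: "z \<in> Q t" "E t z" using hd(7)[OF tH] by (auto simp: nbs_def)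
    then show "Q t \<inter> D \<noteq> {}" using component_closed[OF D(1) t(1)] QR by blast
    show "conn (Q t)" using small_conn hd(4)[OF tH] by blast
  qed (use D in auto)
  then have Deq: "D = insert t (Q t)" using Weq DW DP bPD t(1) by blast
  have "t \<notin> Q t" using hd(5)[OF tH] tH by blast
  \<comment> \<open>A hook with its pendant has 1 + 2 or 1 + 5 vertices.\<close>
  then have "card D = Suc (card (Q t))" using Deq small_finite[OF hd(4)[OF tH]] by simp
  then have "card D \<in> {3, 6}" using small_card[OF hd(4)[OF tH]] by auto
  moreover have "W = insert b (P \<union> D)" using Weq Deq by blast
  ultimately show ?thesis using that W(1) d3 by blast
qed

end

section \<open>The rest at vertices of degree three and four\<close>

lemma card_two_obtain:
  assumes "card A = 2" "x \<in> A"
  obtains y where "A = {x, y}" "y \<noteq> x"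
  using assms by (auto simp: card_2_iff)

context tight_pendant_free
begin

text \<open>The only bad component \<open>P\<close> and a further component \<open>D\<close> have at
  least two links each among three neighbours, so they share some \<open>b\<close>, and the other
  two neighbours are good. The part \<open>W\<close> around \<open>b\<close> uses up the defect 3;
  anything besides \<open>W\<close> would be hooked, with pendants that cannot be left.\<close>

lemma degree_three_rest:
  assumes v: "v \<in> V" "deg V v = 3"
  obtains P where "B v = {P}" "R v = P"
  | P D where "B v = {P}" "component D (R v)" "D \<noteq> P" "R v = P \<union> D" "card D \<in> {3, 6}"
proof -
  have v3: "3 \<le> deg V v" using v by simp
  have "card (B v) = 1" using deg_le_card_B[OF v(1) v3] v by simp
  then obtain P where P: "B v = {P}" by (auto simp: card_1_singleton_iff)
  then have Pb: "P \<in> B v" by simp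
  then have Pc: "component P (R v)" "small P" by (auto simp: bad_def)
  show thesis
  proof (cases "R v = P")
    case True then show thesis using that(1) P by blast
  next
    case False
    then obtain z where z: "z \<in> R v" "z \<notin> P" using component_sub[OF Pc(1)] by blast
    obtain D where D: "component D (R v)" "z \<in> D" using component_exists[OF finR z(1)] .
    have DP: "D \<noteq> P" using D z by blast
    have "lk v P \<inter> lk v D \<noteq> {}"
    proof
      assume "lk v P \<inter> lk v D = {}"
      then have "card (lk v P \<union> lk v D) = card (lk v P) + card (lk v D)"
        using finite_subset[OF lk_sub finN] by (intro card_Un_disjoint)
      moreover have "card (lk v P \<union> lk v D) \<le> deg V v"
        unfolding deg_def using lk_sub by (intro card_mono finN) blast
      ultimately show False
        using card_links_component[OF v(1) v3 Pc(1)] card_links_component[OF v(1) v3 D(1)] v(2) by linarith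
    qed
    then obtain b where b: "b \<in> lk v P" "b \<in> lk v D" by blast
    then have bN: "b \<in> N v" using lk_sub by blast
    have "card (N v - {b}) = 2" using v(2) bN finN card.remove[OF finN bN] by (simp add: deg_def)
    then obtain a c where ac: "N v - {b} = {a, c}" "a \<noteq> c" by (meson card_2_iff)
    have "N v = insert b (N v - {b})" using bN by blast
    then have Nv: "N v = {a, b, c}" unfolding ac(1) by blast
    have "a \<in> N v - {b}" "c \<in> N v - {b}" unfolding ac(1) by simp_all
    then have bac: "b \<noteq> a" "b \<noteq> c" by blast+
    have g: "good v a c" using Nv ac(2) b(1) bac P v(1) unfolding good_def by auto
    have "lk v P \<subseteq> {a, b, c}" using lk_sub Nv by metis
    from adjacent_part[OF g Pb b(1) this bac D(1) DP b(2)]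
    obtain W where W: "component W (V - {v, a, c})" "W = insert b (P \<union> D)" "card D \<in> {3, 6}"
      "3 \<le> defect W (nbs {a, c})" by blast
    let ?F = "V - {v, a, c}" and ?S = "nbs {a, c}"
    let ?K = "?F - W"
    have finK: "finite ?K" using fin by simp
    have "defect W ?S + defect ?K ?S \<le> defect ?F ?S"
      using W(1) fin by (intro defect_closed) (auto simp: component_def)
    then have dK: "defect ?K ?S = 0"
      using W(4) good_defects(2)[OF g] defect_nonneg[OF finK, of ?S] by linarith
    have out: "y \<in> {a, c}" if xy: "x \<in> ?K" "y \<in> V - ?K" "E x y" for x y
    proof -
      have "y \<notin> W" using component_closed[OF W(1), of y x] xy sym by blast
      moreover have "y \<noteq> v"
      proof
        assume "y = v"
        then have "x \<in> N v" using xy sym by auto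
        then show False using Nv xy(1) W(2) by blast
      qed
      ultimately show ?thesis using xy by blast
    qed
    have hitK: "C \<inter> ?S \<noteq> {}" if C: "component C ?K" for C
    proof
      assume n: "C \<inter> ?S = {}"
      have "anticomplete C (V - C)"
        unfolding anticomplete_def
      proof (intro ballI notI)
        fix x y assume xy: "x \<in> C" "y \<in> V - C" "E x y"
        have "y \<notin> ?K" using component_closed[OF C] xy by blast
        then have "y \<in> {a, c}" using out[of x y] component_sub[OF C] xy by blast
        then show False using n xy sym by (auto simp: nbs_def)
      qed
      then have "C = V" using connD[OF connV _ component_ne[OF C]] component_sub[OF C] by blast
      then show False using component_sub[OF C] v(1) by blast
    qed
    \<comment> \<open>A pendant inside \<open>?K\<close> could be left only to \<open>a\<close> or
      \<open>c\<close>, but the vertex where this happens is exempt and thus a hook.\<close>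
    have "?K = {}"
    proof (rule ccontr)
      assume "?K \<noteq> {}"
      then obtain C where C: "component C ?K" using component_exists[OF finK] by blast
      obtain H Q where H: "hooked ?K H Q" "?K \<inter> ?S \<subseteq> H"
        using rooted_hooked[OF finK dK hitK] by blast
      obtain h where h: "h \<in> H" using hitK[OF C] component_sub[OF C] H(2) by blast
      have "?K \<subseteq> V" by blast
      then obtain x y where xy: "x \<in> Q h" "y \<in> V - ?K" "E x y"
        using pendant_leaves[OF H(1) _ h] by blast
      have x: "x \<in> ?K" "x \<notin> H" using hookedD(3,5)[OF H(1) h] xy(1) by blast+
      then have "y \<in> {a, c}" using out xy by blast
      then have "x \<in> ?S" using xy(3) sym by (auto simp: nbs_def)
      then show False using x H(2) by blast
    qed
    moreover have "W \<subseteq> ?F" using component_sub[OF W(1)] .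
    ultimately have FW: "?F = W" by blast
    have "R v = ?F - {b}" using Nv by (auto simp: rest_def)
    moreover have "b \<notin> P \<union> D"
      using component_sub[OF Pc(1)] component_sub[OF D(1)] bN by (auto simp: rest_def)
    ultimately have "R v = P \<union> D" using FW W(2) by blast
    then show thesis using that(2) P D(1) DP W(3) by blast
  qed
qed

text \<open>Two disjoint sets of at least two links each fill the four neighbours.\<close>

lemma degree_four_links:
  assumes v: "v \<in> V" "deg V v = 4"
  obtains P Q where "B v = {P, Q}" "P \<noteq> Q" "lk v P \<inter> lk v Q = {}" "N v = lk v P \<union> lk v Q"
    "card (lk v P) = 2" "card (lk v Q) = 2"
proof -
  have v3: "3 \<le> deg V v" using v by simp
  have "card (B v) = 2" using deg_le_card_B[OF v(1) v3] v by simp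
  then obtain P Q where PQ: "B v = {P, Q}" "P \<noteq> Q" by (auto simp: card_2_iff)
  then have b: "P \<in> B v" "Q \<in> B v" by auto
  have disj: "lk v P \<inter> lk v Q = {}" using disjoint_links[OF v(1) v3 b PQ(2)] .
  have finl: "finite (lk v C)" for C using finite_subset[OF lk_sub finN] .
  have "card (lk v P \<union> lk v Q) = card (lk v P) + card (lk v Q)"
    using disj finl by (intro card_Un_disjoint)
  moreover have "2 \<le> card (lk v P)" "2 \<le> card (lk v Q)"
    using b card_links_ge2[OF v(1)] by (auto simp: bad_def)
  moreover have sub: "lk v P \<union> lk v Q \<subseteq> N v" using lk_sub by blast
  moreover have "card (lk v P \<union> lk v Q) \<le> 4"
    using card_mono[OF finN sub] v(2) by (simp add: deg_def)
  ultimately have c: "card (lk v P) = 2" "card (lk v Q) = 2" "card (lk v P \<union> lk v Q) = 4" by linarith+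
  then have "lk v P \<union> lk v Q = N v" using sub finN v(2) by (intro card_seteq) (auto simp: deg_def)
  then show thesis using that[OF PQ disj] c by simp
qed

text \<open>The part around \<open>b\<close> is a component of \<open>V - {v, a, c}\<close> without
  \<open>d\<close>, of defect at least 3 when the neighbours of \<open>a\<close> and
  \<open>c\<close> are exempt. A second such part around \<open>d\<close> would bring the total to
  6, where only 3 is allowed.\<close>

lemma degree_four_separate:
  assumes v: "v \<in> V" and B: "B v = {P, Q}" "P \<noteq> Q"
    and lk: "lk v P = {a, b}" "lk v Q = {c, d}" "distinct [a, b, c, d]"
    and D: "component D (R v)" "D \<notin> {P, Q}" "b \<in> lk v D"
  shows "\<not> E b d" "\<And>D'. component D' (R v) \<Longrightarrow> D' \<notin> {P, Q} \<Longrightarrow> d \<notin> lk v D'"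
proof -
  let ?F = "V - {v, a, c}" and ?S = "nbs {a, c}"
  have N: "a \<in> N v" "b \<in> N v" "c \<in> N v" "d \<in> N v"
    using lk lk_sub[of v P] lk_sub[of v Q] by auto
  have g: "good v a c" using v N B(1) lk unfolding good_def by auto
  obtain W where W: "component W ?F" "W = insert b (P \<union> D)" "3 \<le> defect W ?S"
    using adjacent_part[OF g, of P b D] B lk D by auto
  have dR: "d \<notin> R v" "d \<in> ?F" "b \<notin> R v" using N lk(3) irrefl by (auto simp: rest_def)
  have Pc: "component P (R v)" "component Q (R v)" using B(1) unfolding bad_def by blast+
  have dW: "d \<notin> W"
    using W(2) dR component_sub[OF Pc(1)] component_sub[OF D(1)] lk(3) by auto
  show "\<not> E b d" using component_closed[OF W(1), of b d] dW dR W(2) by blast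
  fix D' assume D': "component D' (R v)" "D' \<notin> {P, Q}"
  show "d \<notin> lk v D'"
  proof
    assume "d \<in> lk v D'"
    then obtain W' where W': "component W' ?F" "W' = insert d (Q \<union> D')" "3 \<le> defect W' ?S"
      using adjacent_part[OF g, of Q d D'] B lk D' by auto
    have "b \<notin> W'"
      using W'(2) dR component_sub[OF Pc(2)] component_sub[OF D'(1)] lk(3) by auto
    then have "W \<noteq> W'" using W(2) by blast
    then have "component W' (?F - W)" using component_Diff[OF W(1) W'(1)] by blast
    then have "defect W' ?S + defect (?F - W - W') ?S \<le> defect (?F - W) ?S"
      using fin by (intro defect_closed) (auto simp: component_def)
    moreover have "defect W ?S + defect (?F - W) ?S \<le> defect ?F ?S"
      using W(1) fin by (intro defect_closed) (auto simp: component_def)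
    moreover have "0 \<le> defect (?F - W - W') ?S" using fin by (intro defect_nonneg) simp
    ultimately show False using W(3) W'(3) good_defects(2)[OF g] by linarith
  qed
qed

text \<open>A third component \<open>D\<close>, linked at a link \<open>b\<close> of
  \<open>P\<close>, say, must be linked to the other link \<open>a\<close> of \<open>P\<close> too
  and to no link of \<open>Q\<close>. Then \<open>a\<close> has degree at least 3, and
  \<open>Q\<close> with its two links is a component outside the closed neighbourhood of
  \<open>a\<close>, of impossible order.\<close>

lemma degree_four_rest:
  assumes v: "v \<in> V" "deg V v = 4"
  obtains P Q where "B v = {P, Q}" "P \<noteq> Q" "lk v P \<inter> lk v Q = {}"
    "card (lk v P) = 2" "card (lk v Q) = 2" "R v = P \<union> Q"
proof -
  obtain P Q where PQ: "B v = {P, Q}" "P \<noteq> Q" "lk v P \<inter> lk v Q = {}" "N v = lk v P \<union> lk v Q"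
    "card (lk v P) = 2" "card (lk v Q) = 2" using degree_four_links[OF v] .
  have v3: "3 \<le> deg V v" using v by simp
  have "R v \<subseteq> P \<union> Q"
  proof
    fix z assume z: "z \<in> R v"
    show "z \<in> P \<union> Q"
    proof (rule ccontr)
      assume nz: "z \<notin> P \<union> Q"
      obtain D where D: "component D (R v)" "z \<in> D" using component_exists[OF finR z] .
      have DPQ: "D \<notin> {P, Q}" using D(2) nz by blast
      have lkD: "2 \<le> card (lk v D)" using card_links_component[OF v(1) v3 D(1)] .
      then have "lk v D \<noteq> {}" by auto
      then obtain b where b: "b \<in> lk v D" by blast
      \<comment> \<open>Stated for arbitrary \<open>P\<close> and \<open>Q\<close>, since
        \<open>b\<close> may be a link of either one.\<close>
      have False if B: "B v = {P, Q}" "P \<noteq> Q" "lk v P \<inter> lk v Q = {}" "N v = lk v P \<union> lk v Q"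
        "card (lk v P) = 2" "card (lk v Q) = 2" "D \<notin> {P, Q}" and bP: "b \<in> lk v P" for P Q
      proof -
        have Pc: "component P (R v)" "component Q (R v)" "small Q"
          using B(1) unfolding bad_def by blast+
        obtain a where a: "lk v P = {a, b}" "a \<noteq> b"
          using card_two_obtain[OF B(5) bP] by (metis insert_commute)
        obtain c d where cd: "lk v Q = {c, d}" "c \<noteq> d" using B(6) by (auto simp: card_2_iff)
        have dist: "distinct [a, b, c, d]" using a cd B(3) by auto
        have Nv: "N v = {a, b, c, d}" using B(4) a cd by auto
        \<comment> \<open>The separation is applied twice, the second time with \<open>c\<close> and
          \<open>d\<close> exchanged.\<close>
        have bB: "\<not> E b d" "\<not> E b c"
          and noD: "\<And>D'. component D' (R v) \<Longrightarrow> D' \<notin> {P, Q} \<Longrightarrow> d \<notin> lk v D' \<and> c \<notin> lk v D'"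
          using degree_four_separate[OF v(1) B(1,2) a(1) cd(1) dist D(1) B(7) b]
            degree_four_separate[OF v(1) B(1,2) a(1) _ _ D(1) B(7) b, of d c] cd dist
          by auto
        have aD: "a \<in> lk v D"
        proof (rule ccontr)
          assume "a \<notin> lk v D"
          moreover have "lk v D \<subseteq> {a, b, c, d}" using lk_sub[of v D] unfolding Nv .
          ultimately have "lk v D \<subseteq> {b}" using noD[OF D(1) B(7)] by blast
          then have "card (lk v D) \<le> card {b}" by (intro card_mono) auto
          then show False using lkD by simp
        qed
        have aB: "\<not> E a d" "\<not> E a c"
          using degree_four_separate(1)[OF v(1) B(1,2) _ cd(1) _ D(1) B(7) aD, of b] a dist
            degree_four_separate(1)[OF v(1) B(1,2) _ _ _ D(1) B(7) aD, of b d c] cd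
          by auto
        have aV: "a \<in> V" "E v a" "c \<in> V" "d \<in> V" "E v c" "E v d" using Nv by auto
        have mem: "a \<in> lk v P" "c \<in> lk v Q" "d \<in> lk v Q" unfolding a(1) cd(1) by simp_all
        obtain p where p: "p \<in> P" "E a p" using mem(1) by (auto simp: links_def)
        obtain t where t: "t \<in> D" "E a t" using aD by (auto simp: links_def)
        have "P \<inter> D = {}" using component_unique[OF Pc(1) D(1)] B(7) by blast
        then have "p \<noteq> t" using p t by blast
        moreover have RV: "p \<in> R v" "t \<in> R v" using component_sub[OF Pc(1)] component_sub[OF D(1)] p t by blast+
        moreover have "v \<notin> R v" by (simp add: rest_def)
        ultimately have "card {v, p, t} = 3" by (metis card_3_iff)
        moreover have "{v, p, t} \<subseteq> N a" using aV p t RV v(1) sym by (auto simp: rest_def)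
        ultimately have a3: "3 \<le> deg V a" using card_mono[OF finN, of "{v, p, t}" a] by (simp add: deg_def)
        \<comment> \<open>\<open>{c, d} \<union> Q\<close> is a component of \<open>G - N[a]\<close> of order 4 or 7, which no component can have.\<close>
        let ?K = "insert c (insert d Q)"
        obtain x where x: "x \<in> Q" "E c x" using mem(2) by (auto simp: links_def)
        obtain y where y: "y \<in> Q" "E d y" using mem(3) by (auto simp: links_def)
        have "conn (insert d Q)" using conn_insert[OF component_conn[OF Pc(2)] y(1)] y sym by blast
        then have connK: "conn ?K" using conn_insert[of "insert d Q" x c] x sym by blast
        have QR: "Q \<subseteq> R v" using component_sub[OF Pc(2)] .
        have "a \<notin> lk v Q" using cd dist by auto
        then have aQ: "\<not> E a q" if "q \<in> Q" for q using that aV unfolding links_def by auto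
        have KR: "?K \<subseteq> R a"
          using aB aQ aV QR dist sym by (auto simp: rest_def)
        \<comment> \<open>The only component of \<open>R v\<close> linked to \<open>c\<close> or
          \<open>d\<close> is \<open>Q\<close>, and neither vertex is adjacent to
          \<open>b\<close>.\<close>
        have cdK: "y \<in> ?K" if uy: "u \<in> {c, d}" "y \<in> R a" "E u y" for u y
        proof (cases "y \<in> R v")
          case True
          obtain D' where D': "component D' (R v)" "y \<in> D'" using component_exists[OF finR True] .
          have "u \<in> lk v D'" using uy D' aV by (auto simp: links_def)
          then have "D' \<in> {P, Q}" using noD[OF D'(1)] uy(1) by blast
          moreover have "u \<notin> lk v P" using a dist uy(1) by auto
          ultimately have "D' = Q" using \<open>u \<in> lk v D'\<close> by blast
          then show ?thesis using D' by blast
        next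
          case False
          moreover have "y \<noteq> v" using uy(2) aV sym by (auto simp: rest_def)
          moreover have "y \<in> V" using uy(2) by (simp add: rest_def)
          ultimately have "y \<in> N v" by (auto simp: rest_def)
          moreover have "y \<noteq> a" using uy(2) by (simp add: rest_def)
          moreover have "y \<noteq> b" using uy(1,3) bB sym by blast
          ultimately show ?thesis using Nv by blast
        qed
        have "anticomplete ?K (R a - ?K)"
          unfolding anticomplete_def
        proof (intro ballI notI)
          fix x y assume xy: "x \<in> ?K" "y \<in> R a - ?K" "E x y"
          have "x \<notin> {c, d}" using cdK xy by blast
          then have "x \<in> Q" using xy(1) by blast
          moreover have "y \<in> V" using xy(2) by (simp add: rest_def)
          ultimately have "y \<in> Q \<or> y \<in> lk v Q" using component_rest_closed[OF Pc(2)] xy(3) by blast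
          then show False using cd xy(2) by blast
        qed
        then have "component ?K (R a)" using connK KR unfolding component_def by blast
        then have "?K \<in> B a \<or> card ?K mod 3 = 0" by (rule component_of_rest[OF aV(1) a3])
        moreover have "card ?K = 2 + card Q"
        proof -
          have "c \<notin> Q" "d \<notin> Q" using QR aV by (auto simp: rest_def)
          then show ?thesis using small_finite[OF Pc(3)] cd(2) by simp
        qed
        \<comment> \<open>The orders 4 and 7 are neither 2 nor 5 nor divisible by 3.\<close>
        ultimately show False
          using small_card[OF Pc(3)] small_card[of ?K] by (auto simp: bad_def)
      qed
      note * = this
      have "b \<in> lk v P \<or> b \<in> lk v Q" using b lk_sub[of v D] PQ(4) by blast
      then show False
      proof
        assume "b \<in> lk v P"
        then show False by (rule *[OF PQ DPQ])
      next
        assume "b \<in> lk v Q"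
        moreover have "B v = {Q, P}" "Q \<noteq> P" "lk v Q \<inter> lk v P = {}" "N v = lk v Q \<union> lk v P"
          "D \<notin> {Q, P}" using PQ(1-4) DPQ by blast+
        ultimately show False using *[of Q P] PQ(5,6) by blast
      qed
    qed
  qed
  moreover have "P \<in> B v" "Q \<in> B v" unfolding PQ(1) by simp_all
  then have "P \<subseteq> R v" "Q \<subseteq> R v" using component_sub by (auto simp: bad_def)
  ultimately have "R v = P \<union> Q" by blast
  then show thesis by (rule that[OF PQ(1,2,3,5,6)])
qed

section \<open>Excluding degrees three and four\<close>

lemma rest_component_card:
  assumes v: "v \<in> V" "3 \<le> deg V v" and C: "component C (R v)"
  shows "card C \<le> 6"
proof -
  have Bc: "component X (R v)" "card X \<le> 5" if "X \<in> B v" for X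
    using that small_card[of X] by (auto simp: bad_def)
  have eq: "C = X" if "component X (R v)" "C \<inter> X \<noteq> {}" for X
    using component_unique[OF C that] .
  have ne: "C \<noteq> {}" "C \<subseteq> R v" using component_ne[OF C] component_sub[OF C] .
  consider "deg V v = 3" | "deg V v = 4" using deg_le4[OF v(1)] v(2) by linarith
  then show ?thesis
  proof cases
    case 1
    show ?thesis
    proof (rule degree_three_rest[OF v(1) 1])
      fix P assume "B v = {P}" "R v = P"
      then show ?thesis using eq[of P] Bc[of P] ne by fastforce
    next
      fix P D assume "B v = {P}" and D: "component D (R v)" "R v = P \<union> D" "card D \<in> {3, 6}"
      then have P: "component P (R v)" "card P \<le> 5" using Bc[of P] by auto
      have "C = P \<or> C = D" using eq[OF P(1)] eq[OF D(1)] ne D(2) by blast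
      then show ?thesis using P(2) D(3) by auto
    qed
  next
    case 2
    obtain P Q where PQ: "B v = {P, Q}" "R v = P \<union> Q" using degree_four_rest[OF v(1) 2] by metis
    then have c: "component P (R v)" "component Q (R v)" "card P \<le> 5" "card Q \<le> 5" using Bc by auto
    have "C = P \<or> C = Q" using eq[OF c(1)] eq[OF c(2)] ne PQ(2) by blast
    then show ?thesis using c by auto
  qed
qed

lemma isC5_degree:
  assumes "isC5 P" "P \<subseteq> V" "p \<in> P" "b \<in> V - P" "E p b"
  obtains x y where "{b, x, y} \<subseteq> N p" "x \<noteq> y" "x \<in> P" "y \<in> P" "3 \<le> deg V p"
proof -
  obtain x c d y where P: "P = {p, x, c, d, y}" "distinct [p, x, c, d, y]" "E p x" "E y p"
    using isC5_rotate[OF assms(1,3)] by metis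
  have sub: "{b, x, y} \<subseteq> N p" using P assms sym by auto
  moreover have "card {b, x, y} = 3" using P(1,2) assms(4) by auto
  ultimately have "3 \<le> deg V p" using card_mono[OF finN sub] by (simp add: deg_def)
  then show thesis using that[of x y] sub P by auto
qed

lemma no_large_in_rest:
  assumes "v \<in> V" "3 \<le> deg V v" "conn K" "K \<subseteq> R v" "7 \<le> card K"
  shows False
proof -
  obtain z where z: "z \<in> K" using assms(3) by (auto simp: conn_def)
  obtain C where C: "component C (R v)" "z \<in> C" using component_exists[OF finR, of z v] z assms(4) by blast
  have "K \<subseteq> C" using conn_sub_component[OF assms(3,4) C(1)] z C(2) by blast
  moreover have "finite C" using component_sub[OF C(1)] finR finite_subset by blast
  ultimately have "card K \<le> card C" by (intro card_mono)
  then show False using rest_component_card[OF assms(1,2) C(1)] assms(5) by simp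
qed

text \<open>At least ten vertices lie outside the closed neighbourhood of \<open>v\<close>, so
  \<open>P\<close> and \<open>Q\<close> have order 5. A vertex \<open>p\<close> of the 5-cycle
  \<open>P\<close> attached to a link has degree at least 3, and \<open>Q\<close>, a link
  \<open>u\<close> of \<open>Q\<close> and \<open>v\<close> form a connected set of order 7 outside
  its closed neighbourhood.\<close>

lemma no_degree_four:
  assumes n: "15 \<le> card V" and v: "v \<in> V"
  shows "deg V v \<noteq> 4"
proof
  assume d4: "deg V v = 4"
  obtain P Q where PQ: "B v = {P, Q}" "P \<noteq> Q" "lk v P \<inter> lk v Q = {}" "card (lk v P) = 2"
    "card (lk v Q) = 2" "R v = P \<union> Q" using degree_four_rest[OF v d4] .
  have c: "component P (R v)" "component Q (R v)" "small P" "small Q"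
    using PQ(1) unfolding bad_def by blast+
  have "card (R v) \<le> card P + card Q" unfolding PQ(6) by (rule card_Un_le)
  then have "card P = 5" "card Q = 5"
    using rest_card[OF fin v] n d4 small_card[OF c(3)] small_card[OF c(4)] by linarith+
  then have P5: "isC5 P" using c isK2_card unfolding small_def by auto
  have "lk v P \<noteq> {}" "lk v Q \<noteq> {}" using PQ(4,5) by auto
  then obtain b u where b: "b \<in> lk v P" and u: "u \<in> lk v Q" by blast
  obtain p where p: "p \<in> P" "E b p" "b \<in> V" "E v b" using b by (auto simp: links_def)
  obtain q where q: "q \<in> Q" "E u q" "u \<in> V" "E v u" using u by (auto simp: links_def)
  have PV: "P \<subseteq> V" "b \<notin> P" "Q \<subseteq> R v" "u \<notin> Q" "v \<notin> Q"
    using c(1,2)[THEN component_sub] p q by (auto simp: rest_def)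
  have disj: "P \<inter> Q = {}" using component_unique[OF c(1,2)] PQ(2) by blast
  have p3: "3 \<le> deg V p"
    by (rule isC5_degree[OF P5 PV(1) p(1), of b]) (use p PV sym in auto)
  have pR: "p \<in> R v" using c(1) component_sub p(1) by blast
  let ?K = "insert v (insert u Q)"
  have "conn (insert u Q)" using conn_insert[OF component_conn[OF c(2)] q(1)] q(2) sym by blast
  then have "conn ?K" using conn_insert[of "insert u Q" u v] q(4) sym by blast
  moreover have "?K \<subseteq> R p"
  proof -
    have "u \<notin> lk v P" using u PQ(3) by blast
    then have "\<not> E p u" using p(1) q sym by (auto simp: links_def)
    moreover have "\<not> E p v" using pR sym by (auto simp: rest_def)
    moreover have "\<not> E p w" if "w \<in> Q" for w
      using component_closed[OF c(1) p(1)] that disj PV(3) by blast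
    moreover have "p \<noteq> v" "p \<noteq> u" "p \<notin> Q" using pR q disj p(1) by (auto simp: rest_def)
    ultimately show ?thesis using v q(3) PV(3) by (auto simp: rest_def)
  qed
  moreover have "card ?K = 7"
  proof -
    have "v \<noteq> u" using q irrefl by auto
    then show ?thesis using PV \<open>card Q = 5\<close> small_finite[OF c(4)] by simp
  qed
  moreover have "p \<in> V" using p PV by blast
  ultimately show False using no_large_in_rest[OF _ p3, of ?K] by simp
qed

text \<open>At least eleven vertices lie outside the closed neighbourhood of \<open>v\<close>, so
  \<open>P\<close> is a 5-cycle and \<open>D\<close> has order 6. A vertex \<open>p\<close> of
  \<open>P\<close> attached to \<open>b\<close> already has three neighbours, so it is not adjacent
  to a link \<open>u\<close> of \<open>D\<close> other than \<open>b\<close>, and \<open>D\<close>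
  with \<open>u\<close> is connected of order 7 outside the closed neighbourhood of
  \<open>p\<close>.\<close>

lemma no_degree_three:
  assumes n: "15 \<le> card V" and v: "v \<in> V"
  shows "deg V v \<noteq> 3"
proof
  assume d3: "deg V v = 3"
  have v3: "3 \<le> deg V v" using d3 by simp
  show False
  proof (rule degree_three_rest[OF v d3])
    fix P assume P: "B v = {P}" "R v = P"
    then have "small P" unfolding bad_def by blast
    then show False using rest_card[OF fin v] n d3 P(2) small_card[of P] by auto
  next
    fix P D assume P: "B v = {P}" and D: "component D (R v)" "D \<noteq> P" "R v = P \<union> D" "card D \<in> {3, 6}"
    have c: "component P (R v)" "small P" using P unfolding bad_def by blast+
    have "card (R v) \<le> card P + card D" unfolding D(3) by (rule card_Un_le)
    moreover have "card D \<le> 6" "card P \<le> 5" using D(4) small_card[OF c(2)] by auto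
    ultimately have P5: "card P = 5" and D6: "card D = 6"
      using rest_card[OF fin v] n d3 by linarith+
    then have C5: "isC5 P" using c isK2_card unfolding small_def by auto
    have "2 \<le> card (lk v P)" using card_links_component[OF v v3 c(1)] .
    then have "lk v P \<noteq> {}" by auto
    then obtain b where b: "b \<in> lk v P" by blast
    obtain p where p: "p \<in> P" "E b p" "b \<in> V" "E v b" using b by (auto simp: links_def)
    have "\<not> lk v D \<subseteq> {b}"
      using card_links_component[OF v v3 D(1)] card_mono[of "{b}" "lk v D"] by auto
    then obtain u where u: "u \<in> lk v D" "u \<noteq> b" by blast
    obtain t where t: "t \<in> D" "E u t" "u \<in> V" "E v u" using u by (auto simp: links_def)
    have PV: "P \<subseteq> V" "b \<notin> P" "D \<subseteq> R v" "u \<notin> D" "u \<notin> P"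
      using c(1)[THEN component_sub] D(1)[THEN component_sub] p t by (auto simp: rest_def)
    have disj: "P \<inter> D = {}" using component_unique[OF c(1) D(1)] D(2) by blast
    have "b \<in> V - P" "E p b" using p PV sym by auto
    then obtain x y where xy: "{b, x, y} \<subseteq> N p" "x \<noteq> y" "x \<in> P" "y \<in> P" "3 \<le> deg V p"
      using isC5_degree[OF C5 PV(1) p(1)] by blast
    have pV: "p \<in> V" using p PV by blast
    have npu: "\<not> E p u"
    proof
      assume "E p u"
      then have "{u, b, x, y} \<subseteq> N p" using xy t by auto
      moreover have "distinct [u, b, x, y]" using u(2) xy(2-4) PV(2,5) by auto
      then have "card {u, b, x, y} = 4" by simp
      ultimately have "4 \<le> deg V p" using card_mono[OF finN, of "{u, b, x, y}" p] by (simp add: deg_def)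
      then show False using deg_le4[OF pV] no_degree_four[OF n pV] by simp
    qed
    have "conn (insert u D)" using conn_insert[OF component_conn[OF D(1)] t(1)] t(2) sym by blast
    moreover have "insert u D \<subseteq> R p"
    proof -
      have "\<not> E p w" if "w \<in> D" for w
        using component_closed[OF c(1) p(1)] that disj PV(3) by blast
      moreover have "p \<noteq> u" "p \<notin> D" using PV p(1) disj by blast+
      ultimately show ?thesis using npu t(3) PV(3) by (auto simp: rest_def)
    qed
    moreover have "finite D" using component_sub[OF D(1)] finR finite_subset by blast
    then have "card (insert u D) = 7" using PV(4) D6 by simp
    ultimately show False using no_large_in_rest[OF pV xy(5), of "insert u D"] by simp
  qed
qed

section \<open>Cycles\<close>

lemma closed_is_all:
  assumes "A \<subseteq> V" "A \<noteq> {}" "\<And>x. x \<in> A \<Longrightarrow> N x \<subseteq> A"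
  shows "A = V"
proof (rule connD[OF connV assms(1,2)])
  show "anticomplete A (V - A)"
    unfolding anticomplete_def
  proof (intro ballI notI)
    fix x y assume "x \<in> A" "y \<in> V - A" "E x y"
    then have "y \<in> N x" by simp
    then show False using assms(3)[OF \<open>x \<in> A\<close>] \<open>y \<in> V - A\<close> by blast
  qed
qed

text \<open>A vertex \<open>v\<close> of degree 1 and its neighbour \<open>a\<close> would be a
  pendant of the other neighbour \<open>w\<close> of \<open>a\<close>, unless they form the whole
  graph.\<close>

lemma degree_two:
  assumes n: "15 \<le> card V" and v: "v \<in> V"
  shows "deg V v = 2"
proof -
  have le: "deg V x \<le> 2" if "x \<in> V" for x
    using deg_le4[OF that] no_degree_four[OF n that] no_degree_three[OF n that] by linarith
  have "V \<noteq> {v}" using n by auto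
  then obtain a where a: "a \<in> V" "E v a" using conn_edge[OF connV, of "{v}"] v by auto
  have "deg V v \<noteq> 0" using a finN by (auto simp: deg_def)
  moreover have "deg V v \<noteq> 1"
  proof
    assume "deg V v = 1"
    then obtain a' where "N v = {a'}" unfolding deg_def by (meson card_1_singletonE)
    moreover have "a \<in> N v" using a by simp
    ultimately have Nv: "N v = {a}" by simp
    have va: "v \<noteq> a" using a irrefl by blast
    have vN: "v \<in> N a" using a v sym by simp
    show False
    proof (cases "N a \<subseteq> {v}")
      case True
      then have "{v, a} = V" using Nv v a by (intro closed_is_all) auto
      then show False using n card_mono[of "{v, a}" "{v, a}"] va by auto
    next
      case False
      then obtain w where w: "w \<in> N a" "w \<noteq> v" by blast
      have "{v, w} = N a"
        using le[OF a(1)] w vN by (intro card_seteq finN) (auto simp: deg_def)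
      then have "anticomplete {v, a} (V - {w} - {v, a})"
        using Nv unfolding anticomplete_def by auto
      moreover have K2: "isK2 {v, a}" using a(2) unfolding isK2_def by blast
      moreover have "{v, a} \<subseteq> V - {w}" using v a w irrefl by auto
      ultimately have "{v, a} \<in> bad (V - {w}) {}"
        using isK2_conn by (auto simp: bad_def component_def small_def)
      then show False using pf w unfolding pendant_free_def by blast
    qed
  qed
  ultimately show ?thesis using le[OF v] by linarith
qed

lemma next_vertex:
  assumes "15 \<le> card V" "x \<in> V" "y \<in> V" "E x y"
  obtains z where "N y = {x, z}" "z \<noteq> x" "z \<in> V" "E y z" "y \<noteq> z"
proof -
  have "card (N y) = 2" using degree_two[OF assms(1,3)] by (simp add: deg_def)
  moreover have "x \<in> N y" using assms sym by simp
  ultimately obtain z where z: "N y = {x, z}" "z \<noteq> x" by (rule card_two_obtain)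
  then have "z \<in> N y" by simp
  then have "z \<in> V" "E y z" by simp_all
  moreover have "y \<noteq> z" using \<open>E y z\<close> irrefl by blast
  ultimately show thesis using that z by blast
qed

text \<open>All degrees are 2. Of seven consecutive vertices, the second and the sixth dominate all
  but the middle one, which is left isolated. The other vertices contain no bad component, so three
  times the isolation number is at most \<open>6 + (card V - 7)\<close>, less than the
  order.\<close>

theorem order_less_15: "card V < 15"
proof (rule ccontr)
  assume "\<not> ?thesis"
  then have n: "15 \<le> card V" by simp
  note nxt = next_vertex[OF n]
  have small_closed: False if "A \<subseteq> V" "A \<noteq> {}" "\<And>x. x \<in> A \<Longrightarrow> N x \<subseteq> A" "card A \<le> 14" for A
    using closed_is_all[OF that(1-3)] that(4) n by simp
  obtain x1 where x1: "x1 \<in> V" using connV by (auto simp: conn_def)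
  have "card (N x1) = 2" using degree_two[OF n x1] by (simp add: deg_def)
  then obtain x0 x2 where N1: "N x1 = {x0, x2}" "x0 \<noteq> x2" by (auto simp: card_2_iff)
  then have x02: "x0 \<in> V" "x2 \<in> V" "E x1 x0" "E x1 x2" by auto
  obtain x3 where x3: "N x2 = {x1, x3}" "x3 \<noteq> x1" "x3 \<in> V" "E x2 x3" "x2 \<noteq> x3"
    using nxt[OF x1 x02(2,4)] .
  obtain x4 where x4: "N x3 = {x2, x4}" "x4 \<noteq> x2" "x4 \<in> V" "E x3 x4" "x3 \<noteq> x4"
    using nxt[OF x02(2) x3(3,4)] .
  obtain x5 where x5: "N x4 = {x3, x5}" "x5 \<noteq> x3" "x5 \<in> V" "E x4 x5" "x4 \<noteq> x5"
    using nxt[OF x3(3) x4(3,4)] .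
  obtain x6 where x6: "N x5 = {x4, x6}" "x6 \<noteq> x4" "x6 \<in> V" "E x5 x6" "x5 \<noteq> x6"
    using nxt[OF x4(3) x5(3,4)] .
  \<comment> \<open>\<open>u\<close> and \<open>w\<close> continue the walk beyond its two
    ends.\<close>
  obtain u where u: "N x0 = {x1, u}" "u \<noteq> x1" using nxt[OF x1 x02(1,3)] by metis
  obtain w where w: "N x6 = {x5, w}" "w \<noteq> x5" using nxt[OF x5(3) x6(3,4)] by metis
  have backward: "x1 \<in> N x0" "x3 \<in> N x4" "x4 \<in> N x5" "x5 \<in> N x6"
    using x1 x02(3) x3(3) x4(3,4) x5(3,4) x6(4) sym by simp_all
  have x01: "x0 \<noteq> x1" "x1 \<noteq> x2" using x02 irrefl by auto
  have card_le: "card (set xs) \<le> 14" if "length xs \<le> 14" for xs :: "'a list"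
    using card_length[of xs] that by simp
  \<comment> \<open>The walk cannot close up early: otherwise its vertices would form a closed set of order at most 6.\<close>
  have d03: "x0 \<noteq> x3"
  proof
    assume e: "x0 = x3"
    have "x1 \<in> {x2, x4}" using backward(1) unfolding e x4(1) .
    then have "x4 = x1" using x01 by auto
    then have "N x0 \<subseteq> {x0, x1, x2}" unfolding e x4(1) by simp
    moreover have "N x1 \<subseteq> {x0, x1, x2}" "N x2 \<subseteq> {x0, x1, x2}" unfolding N1(1) x3(1) by (simp_all add: e)
    moreover have "card {x0, x1, x2} \<le> 14" using card_le[of "[x0, x1, x2]"] by simp
    moreover have "{x0, x1, x2} \<subseteq> V" using x1 x02 x3(3) x4(3) x5(3) by simp
    ultimately show False by (intro small_closed[of "{x0, x1, x2}"]) blast+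
  qed
  have d14: "x1 \<noteq> x4"
  proof
    assume e: "x1 = x4"
    have "x3 \<in> {x0, x2}" using backward(2) unfolding e[symmetric] N1(1) .
    then show False using d03 x3(5) by auto
  qed
  have d04: "x0 \<noteq> x4"
  proof
    assume e: "x0 = x4"
    have "x1 \<in> {x3, x5}" using backward(1) unfolding e x5(1) .
    then have "x5 = x1" using x3(2) by auto
    then have "N x0 \<subseteq> {x0, x1, x2, x3}" unfolding e x5(1) by simp
    moreover have "N x1 \<subseteq> {x0, x1, x2, x3}" "N x2 \<subseteq> {x0, x1, x2, x3}" unfolding N1(1) x3(1) by (simp_all add: e)
    moreover have "N x3 \<subseteq> {x0, x1, x2, x3}" unfolding x4(1) by (simp add: e)
    moreover have "card {x0, x1, x2, x3} \<le> 14" using card_le[of "[x0, x1, x2, x3]"] by simp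
    moreover have "{x0, x1, x2, x3} \<subseteq> V" using x1 x02 x3(3) x4(3) x5(3) by simp
    ultimately show False by (intro small_closed[of "{x0, x1, x2, x3}"]) blast+
  qed
  have d05: "x0 \<noteq> x5"
  proof
    assume e: "x0 = x5"
    have "x1 \<in> {x4, x6}" using backward(1) unfolding e x6(1) .
    then have "x6 = x1" using d14 by auto
    then have "N x0 \<subseteq> {x0, x1, x2, x3, x4}" unfolding e x6(1) by simp
    moreover have "N x1 \<subseteq> {x0, x1, x2, x3, x4}" "N x2 \<subseteq> {x0, x1, x2, x3, x4}" unfolding N1(1) x3(1) by (simp_all add: e)
    moreover have "N x3 \<subseteq> {x0, x1, x2, x3, x4}" unfolding x4(1) by (simp add: e)
    moreover have "N x4 \<subseteq> {x0, x1, x2, x3, x4}" unfolding x5(1) by (simp add: e)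
    moreover have "card {x0, x1, x2, x3, x4} \<le> 14" using card_le[of "[x0, x1, x2, x3, x4]"] by simp
    moreover have "{x0, x1, x2, x3, x4} \<subseteq> V" using x1 x02 x3(3) x4(3) x5(3) by simp
    ultimately show False by (intro small_closed[of "{x0, x1, x2, x3, x4}"]) blast+
  qed
  have d15: "x1 \<noteq> x5"
  proof
    assume e: "x1 = x5"
    have "x4 \<in> {x0, x2}" using backward(3) unfolding e[symmetric] N1(1) .
    then show False using d04 x4(2) by auto
  qed
  have d25: "x2 \<noteq> x5"
  proof
    assume e: "x2 = x5"
    have "x4 \<in> {x1, x3}" using backward(3) unfolding e[symmetric] x3(1) .
    then show False using d14 x4(5) by auto
  qed
  have d06: "x0 \<noteq> x6"
  proof
    assume e: "x0 = x6"
    have "x1 \<in> {x5, w}" using backward(1) unfolding e w(1) .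
    then have "w = x1" using d15 by auto
    then have "N x0 \<subseteq> {x0, x1, x2, x3, x4, x5}" unfolding e w(1) by simp
    moreover have "N x1 \<subseteq> {x0, x1, x2, x3, x4, x5}" "N x2 \<subseteq> {x0, x1, x2, x3, x4, x5}" unfolding N1(1) x3(1) by (simp_all add: e)
    moreover have "N x3 \<subseteq> {x0, x1, x2, x3, x4, x5}" unfolding x4(1) by (simp add: e)
    moreover have "N x4 \<subseteq> {x0, x1, x2, x3, x4, x5}" unfolding x5(1) by (simp add: e)
    moreover have "N x5 \<subseteq> {x0, x1, x2, x3, x4, x5}" unfolding x6(1) by (simp add: e)
    moreover have "card {x0, x1, x2, x3, x4, x5} \<le> 14" using card_le[of "[x0, x1, x2, x3, x4, x5]"] by simp
    moreover have "{x0, x1, x2, x3, x4, x5} \<subseteq> V" using x1 x02 x3(3) x4(3) x5(3) by simp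
    ultimately show False by (intro small_closed[of "{x0, x1, x2, x3, x4, x5}"]) blast+
  qed
  have d16: "x1 \<noteq> x6"
  proof
    assume e: "x1 = x6"
    have "x5 \<in> {x0, x2}" using backward(4) unfolding e[symmetric] N1(1) .
    then show False using d05 d25 by auto
  qed
  have d26: "x2 \<noteq> x6"
  proof
    assume e: "x2 = x6"
    have "x5 \<in> {x1, x3}" using backward(4) unfolding e[symmetric] x3(1) .
    then show False using d15 x5(2) by auto
  qed
  have d36: "x3 \<noteq> x6"
  proof
    assume e: "x3 = x6"
    have "x5 \<in> {x2, x4}" using backward(4) unfolding e[symmetric] x4(1) .
    then show False using d25 x5(5) by auto
  qed
  have dist: "distinct [x0, x1, x2, x3, x4, x5, x6]"
    using N1(2) x01 x3(2,5) x4(2,5) x5(2,5) x6(2,5) d03 d14 d04 d05 d15 d25 d06 d16 d26 d36 by auto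
  let ?A = "{x0, x1, x2, x3, x4, x5, x6}"
  let ?K = "V - ?A"
  have AV: "?A \<subseteq> V" using x1 x02 x3(3) x4(3) x5(3) x6(3) by simp
  have finK: "finite ?K" using fin by simp
  have cK: "card V = card ?K + 7"
    using card_Diff_subset[of ?A V] AV dist card_mono[OF fin AV] by simp
  have inner: "N x1 \<subseteq> ?A" "N x2 \<subseteq> ?A" "N x3 \<subseteq> ?A" "N x4 \<subseteq> ?A" "N x5 \<subseteq> ?A"
    using N1(1) x3(1) x4(1) x5(1) x6(1) by auto
  \<comment> \<open>A bad component attached to one end of the walk only would be a pendant;
    attached to both ends it forms with the walk a closed set of at most 7 + 5 vertices.\<close>
  have "bad ?K {} = {}"
  proof (rule ccontr)
    assume "bad ?K {} \<noteq> {}"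
    then obtain C where C: "component C ?K" "small C" by (auto simp: bad_def)
    have CV: "C \<subseteq> V - ?A" using component_sub[OF C(1)] .
    have out: "y \<in> {x0, x6}" if "x \<in> C" "y \<in> V - C" "E x y" for x y
    proof -
      have yA: "y \<in> ?A" using component_closed[OF C(1)] that by blast
      have "x \<in> N y" "x \<notin> ?A" using that sym CV by auto
      then have "y \<notin> {x1, x2, x3, x4, x5}" using inner by blast
      then show ?thesis using yA by blast
    qed
    have both: "\<exists>x\<in>C. E x y" if y: "{y, z} = {x0, x6}" for y z
    proof (rule ccontr)
      assume "\<not> ?thesis"
      moreover have "w = z" if "w \<in> {x0, x6}" "w \<noteq> y" for w
        using that unfolding y[symmetric] by blast
      ultimately have "anticomplete C (V - {z} - C)"
        unfolding anticomplete_def using out by blast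
      moreover have "z \<in> ?A" using y by auto
      then have "z \<in> V" "z \<notin> C" using AV CV by blast+
      ultimately have "C \<in> bad (V - {z}) {}"
        using C CV component_conn[OF C(1)] unfolding bad_def component_def by blast
      then show False using pf \<open>z \<in> V\<close> unfolding pendant_free_def by blast
    qed
    have "u \<in> C"
    proof -
      obtain x where x: "x \<in> C" "E x x0" using both[of x0 x6] by blast
      then have "x \<in> N x0" "x \<noteq> x1" using CV sym by auto
      then show ?thesis using u(1) x(1) by auto
    qed
    have "w \<in> C"
    proof -
      obtain x where x: "x \<in> C" "E x x6" using both[of x6 x0] by blast
      then have "x \<in> N x6" "x \<noteq> x5" using CV sym by auto
      then show ?thesis using w(1) x(1) by auto
    qed
    show False
    proof (rule small_closed[of "?A \<union> C"])
      show "?A \<union> C \<subseteq> V" using AV CV by blast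
      fix x assume x: "x \<in> ?A \<union> C"
      show "N x \<subseteq> ?A \<union> C"
      proof (cases "x \<in> C")
        case True
        show ?thesis
        proof
          fix y assume "y \<in> N x"
          then show "y \<in> ?A \<union> C" using out[OF True, of y] by (cases "y \<in> C") auto
        qed
      next
        case False
        then consider "x = x0" | "x = x6" | "x \<in> {x1, x2, x3, x4, x5}" using x by blast
        then show ?thesis
        proof cases
          case 1 then show ?thesis using u(1) \<open>u \<in> C\<close> by auto
        next
          case 2 then show ?thesis using w(1) \<open>w \<in> C\<close> by auto
        next
          case 3 then show ?thesis using inner by blast
        qed
      qed
    next
      have "card (?A \<union> C) \<le> card ?A + card C" by (rule card_Un_le)
      then show "card (?A \<union> C) \<le> 14" using small_card[OF C(2)] dist by auto
    qed simp
  qed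
  then have K: "3 * iso_num ?K {} \<le> card ?K" using defect_nonneg[OF finK, of "{}"] by (simp add: defect_def)
  \<comment> \<open>The vertices dominated by \<open>x1\<close> and \<open>x5\<close>; both
    neighbours of \<open>x3\<close> are among them.\<close>
  let ?T = "{x0, x1, x2, x4, x5, x6}"
  have "iso_num V {} \<le> card {x1, x5} + iso_num (V - ?T) {}"
  proof (rule iso_num_combine[OF fin])
    have "E x5 x4" using sym x5(4) by blast
    then show "?T \<subseteq> {x1, x5} \<union> nbs {x1, x5} \<union> {}" using x02 x6(4) by (auto simp: nbs_def)
  qed (use AV in auto)
  moreover have "V - ?T = {x3} \<union> ?K"
  proof -
    have "x3 \<notin> ?T" using dist by auto
    then show ?thesis using x3(3) by blast
  qed
  moreover have "anticomplete {x3} ?K" using inner(3) unfolding anticomplete_def by auto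
  then have "iso_num ({x3} \<union> ?K) {} \<le> iso_num {x3} {} + iso_num ?K {}" by (rule iso_num_union)
  moreover have "isolates {x3} {} {}" using irrefl by (auto simp: isolates_def)
  then have "iso_num {x3} {} = 0" using iso_num_le by fastforce
  moreover have "card {x1, x5} = 2" using d15 by simp
  ultimately have "iso_num V {} \<le> 2 + iso_num ?K {}" by simp
  then show False using K cK tight by linarith
qed

end

context ugraph
begin

theorem tight_imp_hooked:
  assumes fin: "finite V" and V: "conn V" and t: "card V = 3 * iso_num V {}" and n: "15 \<le> card V"
  shows "\<exists>H P. hooked V H P"
proof -
  have "\<not> pendant_free V"
  proof
    assume "pendant_free V"
    then interpret tight_pendant_free E V using fin V t by unfold_locales
    show False using order_less_15 n by simp
  qed
  then obtain s C where "s \<in> V" "C \<in> bad (V - {s}) {}" unfolding pendant_free_def by blast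
  then show ?thesis using hooked_if_pendant[OF fin V] t by simp
qed

end

section \<open>Membership in the hook family\<close>

lemma ugraph_of_pair_graph:
  assumes "pair_graph G"
  shows "ugraph (\<lambda>x y. (x, y) \<in> parcs G)"
proof -
  interpret pair_graph G by fact
  show ?thesis
  proof
    show "(y, x) \<in> parcs G" if "(x, y) \<in> parcs G" for x y
      using that pair_sym_arcs unfolding symmetric_def by (auto dest: symD)
    show "(x, x) \<notin> parcs G" for x using pair_no_loops[of "(x, x)"] by auto
  qed
qed

text \<open>A set without leaving edges cannot be left along a walk in the symmetric closure, which
  adds no arcs here.\<close>

lemma connected_imp_conn:
  assumes "pair_graph G" "connected G"
  shows "ugraph.conn (\<lambda>x y. (x, y) \<in> parcs G) (pverts G)"
proof -
  interpret ugraph "\<lambda>x y. (x, y) \<in> parcs G" using ugraph_of_pair_graph[OF assms(1)] .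
  let ?M = "mk_symmetric (with_proj G)"
  have M: "pverts ?M = pverts G" "\<And>x y. (x, y) \<in> parcs ?M \<Longrightarrow> (x, y) \<in> parcs G"
    using sym by (auto simp: mk_symmetric_def)
  have ne: "pverts G \<noteq> {}" and reach: "\<And>u v. u \<in> pverts G \<Longrightarrow> v \<in> pverts G \<Longrightarrow> u \<rightarrow>\<^sup>*\<^bsub>with_proj ?M\<^esub> v"
    using assms(2) M(1) unfolding connected_def strongly_connected_def by auto
  show ?thesis
    unfolding conn_def
  proof (intro conjI allI impI)
    fix A assume A: "A \<subseteq> pverts G" "A \<noteq> {}" "anticomplete A (pverts G - A)"
    obtain a where a: "a \<in> A" using A(2) by blast
    have "v \<in> A" if v: "v \<in> pverts G" for v
    proof -
      have "(a, v) \<in> rtrancl_on (pverts G) (parcs ?M)"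
        using reach[of a v] a A(1) v M(1) by (auto simp: reachable_def)
      then show ?thesis
      proof (induction rule: rtrancl_on_induct)
        case base then show ?case using a by blast
      next
        case (step y z)
        then show ?case using M(2) A(3) unfolding anticomplete_def by blast
      qed
    qed
    then show "A = pverts G" using A(1) by blast
  qed (rule ne)
qed

text \<open>The set of vertices reachable from \<open>u\<close> has no leaving edge, so the cut
  condition makes it everything.\<close>

lemma conn_imp_connected:
  assumes "pair_graph B" "ugraph.conn (\<lambda>x y. (x, y) \<in> parcs B) (pverts B)"
  shows "connected B"
proof -
  interpret ugraph "\<lambda>x y. (x, y) \<in> parcs B" using ugraph_of_pair_graph[OF assms(1)] .
  let ?M = "mk_symmetric (with_proj B)"
  have M: "pverts ?M = pverts B" "parcs B \<subseteq> parcs ?M" by (auto simp: mk_symmetric_def)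
  have "v \<in> {w. u \<rightarrow>\<^sup>*\<^bsub>with_proj ?M\<^esub> w}" if uv: "u \<in> pverts B" "v \<in> pverts B" for u v
  proof -
    let ?A = "{w. u \<rightarrow>\<^sup>*\<^bsub>with_proj ?M\<^esub> w}"
    have uA: "u \<in> ?A" using uv M by (auto simp: reachable_def)
    have sub: "?A \<subseteq> pverts B" using M by (auto elim!: reachable_in_vertsE)
    have "anticomplete ?A (pverts B - ?A)"
      unfolding anticomplete_def
    proof (intro ballI notI)
      fix x y assume x: "x \<in> ?A" and y: "y \<in> pverts B - ?A" and e: "(x, y) \<in> parcs B"
      have "u \<rightarrow>\<^sup>*\<^bsub>with_proj ?M\<^esub> y"
        using x y e M unfolding reachable_def by (auto intro: rtrancl_on_into_rtrancl_on)
      then show False using y by blast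
    qed
    then have "?A = pverts B" using connD[OF assms(2) sub] uA by blast
    then show ?thesis using uv by blast
  qed
  moreover have "pverts B \<noteq> {}" using assms(2) by (simp add: conn_def)
  ultimately show ?thesis using M(1) unfolding connected_def strongly_connected_def by simp
qed

lemma isolating_iff_isolates:
  assumes "pair_graph G"
  shows "isolating G X \<longleftrightarrow> ugraph.isolates (\<lambda>x y. (x, y) \<in> parcs G) (pverts G) {} X"
proof -
  interpret pair_graph G by fact
  interpret ugraph "\<lambda>x y. (x, y) \<in> parcs G" using ugraph_of_pair_graph[OF assms] .
  have "closed_nbhd G X = X \<union> nbs X" by (simp add: closed_nbhd_def nbs_def)
  then show ?thesis
    unfolding isolating_def isolates_def using in_arcsD1 in_arcsD2 by auto
qed

lemma isolation_number_eq_iso_num: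
  assumes "pair_graph G"
  shows "isolation_number G = ugraph.iso_num (\<lambda>x y. (x, y) \<in> parcs G) (pverts G) {}"
proof -
  interpret pair_graph G by fact
  interpret ugraph "\<lambda>x y. (x, y) \<in> parcs G" using ugraph_of_pair_graph[OF assms] .
  note iff = isolating_iff_isolates[OF assms]
  have "finite {X. isolating G X}"
    by (rule finite_subset[of _ "Pow (pverts G)"]) (auto simp: isolating_def pair_finite_verts)
  moreover obtain X where "isolates (pverts G) {} X" "card X = iso_num (pverts G) {}"
    by (rule iso_num_ex)
  ultimately show ?thesis
    unfolding isolation_number_def iff using iso_num_le by (intro Min_eqI) force+
qed

section \<open>Assembling a member of the family\<close>

definition induced :: "'a pair_pre_digraph \<Rightarrow> 'a set \<Rightarrow> 'a pair_pre_digraph" where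
  "induced G W = \<lparr> pverts = W, parcs = {(x, y) \<in> parcs G. x \<in> W \<and> y \<in> W} \<rparr>"

lemma induced_simps [simp]:
  "pverts (induced G W) = W" "(x, y) \<in> parcs (induced G W) \<longleftrightarrow> (x, y) \<in> parcs G \<and> x \<in> W \<and> y \<in> W"
  by (auto simp: induced_def)

lemma pair_graph_induced:
  assumes "pair_graph G" "W \<subseteq> pverts G"
  shows "pair_graph (induced G W)"
proof -
  interpret pair_graph G by fact
  interpret ugraph "\<lambda>x y. (x, y) \<in> parcs G" using ugraph_of_pair_graph[OF assms(1)] .
  have "finite (parcs (induced G W))"
    using pair_finite_arcs by (rule rev_finite_subset) (auto simp: induced_def)
  moreover have "finite W" using assms(2) pair_finite_verts by (rule finite_subset)
  moreover have "symmetric (with_proj (induced G W))"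
    using sym by (auto simp: symmetric_def intro!: symI)
  moreover have "fst e \<noteq> snd e" if "e \<in> parcs (induced G W)" for e
    using that irrefl by (cases e) auto
  ultimately show ?thesis
    by unfold_locales (auto simp: induced_def)
qed

text \<open>A 5-cycle is read starting with an edge \<open>x y\<close> that avoids \<open>A\<close>.
  Then \<open>A\<close> lies in the three consecutive vertices after it, so it has one or two
  elements or consists of all three.\<close>

lemma pendant_induced:
  assumes G: "pair_graph G"
    and small: "ugraph.small (\<lambda>x y. (x, y) \<in> parcs G) C" and A: "A \<subseteq> C" "A \<noteq> {}"
    and C5: "ugraph.isC5 (\<lambda>x y. (x, y) \<in> parcs G) C \<Longrightarrow> \<exists>x\<in>C - A. \<exists>y\<in>C - A. (x, y) \<in> parcs G"
  shows "pendant (induced G C) A"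
proof -
  interpret ugraph "\<lambda>x y. (x, y) \<in> parcs G" using ugraph_of_pair_graph[OF G] .
  have finA: "finite A" using small_finite[OF small] A(1) finite_subset by blast
  then have cA: "1 \<le> card A" using A(2) by (simp add: Suc_le_eq card_gt_0_iff)
  show ?thesis
  proof (cases "isK2 C")
    case True
    then obtain p q where pq: "C = {p, q}" "(p, q) \<in> parcs G" unfolding isK2_def by blast
    then have ne: "p \<noteq> q" "(q, p) \<in> parcs G" using irrefl sym by blast+
    have "complete_digraph 2 (with_proj (induced G C))"
      unfolding complete_digraph_pair_def using pq ne irrefl by (auto simp: induced_def)
    moreover have "card A \<le> 2" using card_mono[OF small_finite[OF small] A(1)] isK2_card[OF True] by simp
    then have "card A \<in> {1, 2}" using cA by auto
    ultimately show ?thesis using A(1) unfolding pendant_def by simp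
  next
    case False
    then have isC5: "isC5 C" using small by (simp add: small_def)
    from C5[OF this] obtain x y where xy: "x \<in> C - A" "y \<in> C - A" "(x, y) \<in> parcs G" by blast
    obtain b c d e where C: "C = {x, b, c, d, e}" "distinct [x, b, c, d, e]"
      "(x, b) \<in> parcs G" "(b, c) \<in> parcs G" "(c, d) \<in> parcs G" "(d, e) \<in> parcs G" "(e, x) \<in> parcs G"
      "(x, c) \<notin> parcs G" "(x, d) \<notin> parcs G" "(b, d) \<notin> parcs G" "(b, e) \<notin> parcs G" "(c, e) \<notin> parcs G"
      using isC5_rotate[OF isC5, of x] xy by blast
    have sy: "(u, v) \<in> parcs G \<longleftrightarrow> (v, u) \<in> parcs G" for u v using sym by blast
    have "y \<noteq> x" using xy(3) irrefl by blast
    then have "y = b \<or> y = e" using xy C by blast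
    \<comment> \<open>If \<open>y\<close> precedes \<open>x\<close> on the cycle, the cycle is
      reversed.\<close>
    then obtain c2 c3 c4 where D: "C = {x, y, c2, c3, c4}" "distinct [x, y, c2, c3, c4]"
      "(y, c2) \<in> parcs G" "(c2, c3) \<in> parcs G" "(c3, c4) \<in> parcs G" "(c4, x) \<in> parcs G"
      "(x, c2) \<notin> parcs G" "(x, c3) \<notin> parcs G" "(y, c3) \<notin> parcs G" "(y, c4) \<notin> parcs G" "(c2, c4) \<notin> parcs G"
    proof
      assume "y = b" then show thesis using that[of c d e] C by blast
    next
      assume y: "y = e"
      show thesis
      proof (rule that[of d c b])
        show "C = {x, y, d, c, b}" using C(1) y by blast
        show "distinct [x, y, d, c, b]" using C(2) y by auto
      qed (use C y sy in blast)+
    qed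
    let ?c = "\<lambda>i. [x, y, c2, c3, c4] ! i"
    have nth: "?c 0 = x" "?c 1 = y" "?c (Suc 0) = y" "?c 2 = c2" "?c 3 = c3" "?c 4 = c4" by simp_all
    have lt5: "{..<5::nat} = {0, 1, 2, 3, 4}" by auto
    have inj: "inj_on ?c {..<5}" using inj_on_nth[OF D(2), of "{..<5}"] by simp
    have "induced G C = cycle_graph 5 ?c"
    proof -
      define L where "L = {(x, y), (y, x), (y, c2), (c2, y), (c2, c3), (c3, c2), (c3, c4), (c4, c3),
        (c4, x), (x, c4)}"
      have "?c ` {..<5} = C" unfolding lt5 D(1) by (simp only: image_insert image_empty nth)
      moreover have "(\<Union>i<5. {(?c i, ?c (Suc i mod 5)), (?c (Suc i mod 5), ?c i)}) = L"
        unfolding lt5 L_def by auto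
      moreover have "{(u, v). (u, v) \<in> parcs G \<and> u \<in> C \<and> v \<in> C} = L"
      proof (rule set_eqI)
        fix e :: "'a \<times> 'a"
        obtain u v where e: "e = (u, v)" by (cases e)
        have "L \<subseteq> C \<times> C" unfolding L_def D(1) by simp
        then have "e \<in> L \<Longrightarrow> u \<in> C \<and> v \<in> C" using e by blast
        moreover have "(u, v) \<in> parcs G \<longleftrightarrow> (u, v) \<in> L" if uv: "u \<in> C" "v \<in> C"
        proof -
          have u: "u = x \<or> u = y \<or> u = c2 \<or> u = c3 \<or> u = c4" using uv(1) D(1) by blast
          have v: "v = x \<or> v = y \<or> v = c2 \<or> v = c3 \<or> v = c4" using uv(2) D(1) by blast
          have rev: "distinct [c4, c3, c2, y, x]" using D(2) by auto
          have nonadj: "(c2, x) \<notin> parcs G" "(c3, x) \<notin> parcs G" "(c3, y) \<notin> parcs G"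
            "(c4, y) \<notin> parcs G" "(c4, c2) \<notin> parcs G" using D(7-11) sy by blast+
          note adj = xy(3) D(3-6) xy(3)[THEN sym] D(3-6)[THEN sym]
          from u v show ?thesis
            unfolding L_def
            by (elim disjE) (simp_all add: adj nonadj D(7-11) irrefl D(2)[simplified] rev[simplified])
        qed
        ultimately show "e \<in> {(u, v). (u, v) \<in> parcs G \<and> u \<in> C \<and> v \<in> C} \<longleftrightarrow> e \<in> L"
          using e by auto
      qed
      ultimately show ?thesis unfolding induced_def cycle_graph_def by simp
    qed
    moreover have "card A \<in> {1, 2} \<or> A = {c2, c3, c4}"
    proof -
      have sub: "A \<subseteq> {c2, c3, c4}" using A(1) D(1) xy by blast
      have "card A \<le> 3" using card_mono[OF _ sub] D(2) by simp
      then consider "card A \<in> {1, 2}" | "card A = 3" using cA by fastforce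
      then show ?thesis using card_seteq[OF _ sub] D(2) by cases auto
    qed
    then have "card A \<in> {1, 2} \<or> (\<exists>i<5. A = {?c i, ?c ((i + 1) mod 5), ?c ((i + 2) mod 5)})"
    proof
      assume "A = {c2, c3, c4}"
      then have "A = {?c 2, ?c ((2 + 1) mod 5), ?c ((2 + 2) mod 5)}" by simp
      moreover have "(2::nat) < 5" by simp
      ultimately show ?thesis by blast
    qed simp
    ultimately show ?thesis using inj A(1) unfolding pendant_def by (metis induced_simps(1))
  qed
qed

text \<open>The base graph is induced on \<open>H\<close>, and each hook \<open>h\<close> is joined
  to its neighbours in \<open>P h\<close>. An edge that is not between hooks has an end in some
  pendant, so it lies inside that pendant or goes to its hook.\<close>

lemma hooked_in_family:
  assumes G: "pair_graph G" and conn: "ugraph.conn (\<lambda>x y. (x, y) \<in> parcs G) (pverts G)"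
    and h: "ugraph.hooked (\<lambda>x y. (x, y) \<in> parcs G) (pverts G) H P"
  shows "G \<in> hook_family"
proof -
  interpret pair_graph G by fact
  interpret ugraph "\<lambda>x y. (x, y) \<in> parcs G" using ugraph_of_pair_graph[OF G] .
  note hd = hookedD[OF h]
  let ?B = "induced G H"
  let ?P = "\<lambda>h. induced G (P h)"
  let ?A = "\<lambda>h. P h \<inter> nbs {h}"
  have B: "pair_graph ?B" using pair_graph_induced[OF G hd(2)] .
  interpret B: ugraph "\<lambda>x y. (x, y) \<in> parcs ?B" using ugraph_of_pair_graph[OF B] .
  have "B.conn H"
    using hooked_conn[OF h conn] unfolding conn_def B.conn_def anticomplete_def B.anticomplete_def
    by auto
  then have cB: "connected ?B" using conn_imp_connected[OF B] by simp
  have pend: "pendant (?P h) (?A h)" if hH: "h \<in> H" for h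
  proof (rule pendant_induced[OF G hd(4)[OF hH] _ hd(7)[OF hH]])
    assume "isC5 (P h)"
    then obtain x y where "x \<in> P h" "y \<in> P h" "(x, y) \<in> parcs G" "(h, x) \<notin> parcs G" "(h, y) \<notin> parcs G"
      using h hH unfolding hooked_def by blast
    then show "\<exists>x\<in>P h - ?A h. \<exists>y\<in>P h - ?A h. (x, y) \<in> parcs G"
      unfolding nbs_def by blast
  qed simp
  have arcs: "parcs G = parcs ?B \<union> (\<Union>h\<in>H. parcs (?P h) \<union> {h} \<times> ?A h \<union> ?A h \<times> {h})" (is "_ = ?R")
  proof (rule set_eqI)
    fix e :: "'a \<times> 'a"
    obtain x y where e: "e = (x, y)" by (cases e)
    have "(x, y) \<in> ?R" if xy: "(x, y) \<in> parcs G"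
    proof (cases "x \<in> H \<and> y \<in> H")
      case True then show ?thesis using xy by simp
    next
      case False
      have V: "x \<in> pverts G" "y \<in> pverts G" using xy in_arcsD1 in_arcsD2 by blast+
      have one: "y' = h \<or> y' \<in> P h" if "h \<in> H" "x' \<in> P h" "(x', y') \<in> parcs G" for h x' y'
        using hd(6)[OF that(1)] that(2,3) in_arcsD2[OF that(3)] unfolding anticomplete_def by blast
      from False V hd(1) obtain h where "h \<in> H" "x \<in> P h \<or> y \<in> P h" by blast
      then show ?thesis using one[of h x y] one[of h y x] xy sym[OF xy] by auto
    qed
    moreover have "(x, y) \<in> parcs G" if "(x, y) \<in> ?R" using that sym by auto
    ultimately show "e \<in> parcs G \<longleftrightarrow> e \<in> ?R" using e by blast
  qed
  show ?thesis
    unfolding hook_family_def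
  proof (intro CollectI exI conjI)
    show "G = \<lparr>pverts = pverts ?B \<union> (\<Union>h\<in>pverts ?B. pverts (?P h)),
      parcs = parcs ?B \<union> (\<Union>h\<in>pverts ?B. parcs (?P h) \<union> {h} \<times> ?A h \<union> ?A h \<times> {h})\<rparr>"
      using arcs hd(1) by (intro pair_pre_digraph.equality) simp_all
  qed (use B cB pend hd(5,8) in auto)
qed

theorem theorem5:
  fixes G :: "'a pair_pre_digraph" and n :: nat
  assumes "n \<ge> 15"
    and "pair_graph G" and "connected G"
    and "card (pverts G) = n"
    and "real (isolation_number G) = real n / 3"
  shows "G \<in> hook_family"
proof -
  interpret pair_graph G by fact
  interpret ugraph "\<lambda>x y. (x, y) \<in> parcs G" using ugraph_of_pair_graph[OF assms(2)] .
  have conn: "conn (pverts G)" using connected_imp_conn[OF assms(2,3)] .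
  have "card (pverts G) = 3 * iso_num (pverts G) {}"
    using assms(4,5) isolation_number_eq_iso_num[OF assms(2)] by simp
  then obtain H P where "hooked (pverts G) H P"
    using tight_imp_hooked[OF pair_finite_verts conn] assms(1,4) by auto
  then show ?thesis by (rule hooked_in_family[OF assms(2) conn])
qed

end
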